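(* Let $T$ be a totally ordered set and $\mu$ a non-degenerate probability measure on $T$, with set of atoms $\mathcal{A}$, atom masses $m_\alpha=\mu(\{\alpha\})$ and diffuse mass $m_d=\mu(T\setminus\mathcal{A})$. Then for all $z\in\mathbb{C}\setminus\{0\}$ the probability generating functions of the strict and non-strict run lengths satisfy $$G_{N_0^{<}}(z)=\frac1z\Big(1+(z-1)e^{m_d z}\prod_{\alpha\in\mathcal{A}}(1+m_\alpha z)\Big),$$ and, when $|z|\le 1$, $$G_{N_0^{\le}}(z)=\frac1z\Big(1+(z-1)e^{m_d z}\prod_{\alpha\in\mathcal{A}}\frac{1}{1-m_\alpha z}\Big).$$ Moreover, for every $i\ge 1$ and all $z\in\mathbb{C}\setminus\{0\}$, $$G_{N_i^{<}}(z)=1+\frac{2(z-1)}{z\big(1+\sum_{\alpha\in\mathcal{A}}m_\alpha^2\big)}\,G_{N_0^{<}}(z),$$ and, when $|z|\le 1$, $$G_{N_i^{\le}}(z)=1+\frac{2(z-1)}{z\big(1-\sum_{\alpha\in\mathcal{A}}m_\alpha^2\big)}\,G_{N_0^{\le}}(z).$$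
   Context: $T$ carries a $\sigma$-algebra such that $\{(x,y)\in T^2: x<y\}$ is measurable for the product $\sigma$-algebra on $T^2$ (since $T$ is totally ordered, $\{x\le y\}$ and all singletons are then measurable too). Measures on $T$ are defined on this $\sigma$-algebra. Atoms: $\mathcal{A}=\{x\in T:\mu(\{x\})>0\}$ (a countable set). $\mu$ is degenerate if there is $x\in T$ with $\mu(\{x\})=\mu(T)$, and non-degenerate otherwise. Runs: $X_0,X_1,X_2,\dots$ are i.i.d. $T$-valued random variables with law $\mu$ on a probability space $(\Omega,\mathcal{F},\mathbb{P})$. The event that a strict run begins at $i$ is $S_0^{<}=\Omega$ and $S_i^{<}=\{X_{i-1}\not< X_i\}$ for $i\ge1$; the event that a non-strict run begins at $i$ is $S_0^{\le}=\Omega$ and $S_i^{\le}=\{X_{i-1}\not\le X_i\}$ for $i\ge1$. The run length $N_i^{<}$ is defined only on $S_i^{<}$, with values in $\{1,2,\dots\}\cup\{\infty\}$: for finite $n\ge1$, $\{N_i^{<}=n\}=S_i^{<}\cap\{X_i<X_{i+1}<\dots<X_{i+n-1}\}\cap\{X_{i+n-1}\not<X_{i+n}\}$ (the chain condition being vacuous for $n=1$), and $\{N_i^{<}=\infty\}=S_i^{<}\cap\{X_i<X_{i+1}<\cdots\}$. $N_i^{\le}$ is defined on $S_i^{\le}$ in the same way with $<,\not<$ replaced by $\le,\not\le$. The PGFs are $G_{N_i^{<}}(Z)=\sum_{n=0}^\infty\mathbb{P}(N_i^{<}=n\mid S_i^{<})Z^n$ and $G_{N_i^{\le}}(Z)=\sum_{n=0}^\infty\mathbb{P}(N_i^{\le}=n\mid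 S_i^{\le})Z^n$; evaluated at a complex number $z$ they denote the sums of these (convergent) series. *)

theory Defs
  imports "HOL-Probability.Probability"
begin

definition atoms :: "'a measure \<Rightarrow> 'a set" where
  "atoms M = {x \<in> space M. measure M {x} > 0}"

definition diffuse_mass :: "'a measure \<Rightarrow> real" where
  "diffuse_mass M = measure M (space M - atoms M)"

definition degenerate :: "'a measure \<Rightarrow> bool" where
  "degenerate M \<longleftrightarrow> (\<exists>x\<in>space M. measure M {x} = measure M (space M))"

(* Unordered products over an arbitrary index set, the multiplicative analogue of summable_on and
   infsum: the limit is along the net of finite subsets of A. In contrast to convergent_prod,
   a limit (or a factor) equal to zero is allowed. *)

definition prod_convergent_on :: "('a \<Rightarrow> complex) \<Rightarrow> 'a set \<Rightarrow> bool" where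
  "prod_convergent_on f A \<longleftrightarrow> (\<exists>p. (prod f \<longlongrightarrow> p) (finite_subsets_at_top A))"

definition infprod :: "('a \<Rightarrow> complex) \<Rightarrow> 'a set \<Rightarrow> complex" where
  "infprod f A = Lim (finite_subsets_at_top A) (prod f)"

(* Runs with respect to a relation r, which is (<) for strict and (\<le>) for non-strict runs. *)

definition run_begins :: "('a \<Rightarrow> 'a \<Rightarrow> bool) \<Rightarrow> 'w measure \<Rightarrow> (nat \<Rightarrow> 'w \<Rightarrow> 'a) \<Rightarrow> nat \<Rightarrow> 'w set" where
  "run_begins r P X i = {\<omega> \<in> space P. i = 0 \<or> \<not> r (X (i - 1) \<omega>) (X i \<omega>)}"

definition finite_run :: "('a \<Rightarrow> 'a \<Rightarrow> bool) \<Rightarrow> (nat \<Rightarrow> 'a) \<Rightarrow> nat \<Rightarrow> nat \<Rightarrow> bool" where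
  "finite_run r x i n \<longleftrightarrow>
     n \<ge> 1 \<and> (\<forall>j. i \<le> j \<and> j < i + n - 1 \<longrightarrow> r (x j) (x (j + 1))) \<and> \<not> r (x (i + n - 1)) (x (i + n))"

(* A total function of \<omega>; only its values on run_begins r P X i are ever used. *)
definition run_length :: "('a \<Rightarrow> 'a \<Rightarrow> bool) \<Rightarrow> (nat \<Rightarrow> 'w \<Rightarrow> 'a) \<Rightarrow> nat \<Rightarrow> 'w \<Rightarrow> enat" where
  "run_length r X i \<omega> =
     (if \<forall>j\<ge>i. r (X j \<omega>) (X (j + 1) \<omega>) then \<infinity>
      else enat (THE n. finite_run r (\<lambda>j. X j \<omega>) i n))"

lemma finite_run_unique:
  assumes "finite_run r x i m" "finite_run r x i n"
  shows "m = n"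
proof -
  have *: False if "finite_run r x i m" "finite_run r x i n" "m < n" for m n
  proof -
    have bounds: "i \<le> i + m - 1 \<and> i + m - 1 < i + n - 1" and eq: "i + m - 1 + 1 = i + m"
      using that unfolding finite_run_def by auto
    have "r (x (i + m - 1)) (x (i + m - 1 + 1))"
      using that(2) bounds unfolding finite_run_def by blast
    then show False
      using that(1) unfolding eq by (simp add: finite_run_def)
  qed
  show ?thesis
    using *[of m n] *[of n m] assms by (meson nat_neq_iff)
qed

lemma finite_run_exists:
  assumes "\<not> (\<forall>j\<ge>i. r (x j) (x (j + 1)))"
  shows "\<exists>n. finite_run r x i n"
proof -
  define k where "k = (LEAST j. j \<ge> i \<and> \<not> r (x j) (x (j + 1)))"
  have k: "k \<ge> i \<and> \<not> r (x k) (x (k + 1))"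
    unfolding k_def by (rule LeastI_ex) (use assms in blast)
  have "r (x j) (x (j + 1))" if "i \<le> j" "j < k" for j
    using not_less_Least[of j "\<lambda>j. j \<ge> i \<and> \<not> r (x j) (x (j + 1))"] that
    unfolding k_def by blast
  then have "finite_run r x i (k + 1 - i)"
    using k unfolding finite_run_def by auto
  then show ?thesis ..
qed

lemma run_length_eq_enat_iff:
  "run_length r X i \<omega> = enat n \<longleftrightarrow> finite_run r (\<lambda>j. X j \<omega>) i n"
proof (cases "\<forall>j\<ge>i. r (X j \<omega>) (X (j + 1) \<omega>)")
  case True
  have "\<not> finite_run r (\<lambda>j. X j \<omega>) i n"
  proof
    assume run: "finite_run r (\<lambda>j. X j \<omega>) i n"
    then have bound: "i + n - 1 \<ge> i" and eq: "i + n - 1 + 1 = i + n"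
      by (auto simp: finite_run_def)
    have "r (X (i + n - 1) \<omega>) (X (i + n) \<omega>)"
      using True[rule_format, OF bound] unfolding eq .
    with run show False
      by (simp add: finite_run_def)
  qed
  with True show ?thesis by (simp add: run_length_def)
next
  case False
  then obtain m where m: "finite_run r (\<lambda>j. X j \<omega>) i m"
    using finite_run_exists[of i r "\<lambda>j. X j \<omega>"] by blast
  then have "(THE n. finite_run r (\<lambda>j. X j \<omega>) i n) = m"
    by (rule the_equality) (rule finite_run_unique[OF _ m])
  then have len: "run_length r X i \<omega> = enat m"
    using False unfolding run_length_def by simp
  have "m = n \<longleftrightarrow> finite_run r (\<lambda>j. X j \<omega>) i n"
  proof
    assume "m = n"
    with m show "finite_run r (\<lambda>j. X j \<omega>) i n" by simp
  next
    assume "finite_run r (\<lambda>j. X j \<omega>) i n"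
    with m show "m = n" by (rule finite_run_unique)
  qed
  then show ?thesis
    by (simp only: len enat.inject)
qed

lemma run_length_eq_infinity_iff:
  "run_length r X i \<omega> = \<infinity> \<longleftrightarrow> (\<forall>j\<ge>i. r (X j \<omega>) (X (j + 1) \<omega>))"
  by (simp add: run_length_def)

definition run_pmf ::
  "('a \<Rightarrow> 'a \<Rightarrow> bool) \<Rightarrow> 'w measure \<Rightarrow> (nat \<Rightarrow> 'w \<Rightarrow> 'a) \<Rightarrow> nat \<Rightarrow> nat \<Rightarrow> real" where
  "run_pmf r P X i n = \<P>(\<omega> in P. run_length r X i \<omega> = enat n \<bar> \<omega> \<in> run_begins r P X i)"

definition run_pgf_converges ::
  "('a \<Rightarrow> 'a \<Rightarrow> bool) \<Rightarrow> 'w measure \<Rightarrow> (nat \<Rightarrow> 'w \<Rightarrow> 'a) \<Rightarrow> nat \<Rightarrow> complex \<Rightarrow> bool" where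
  "run_pgf_converges r P X i z \<longleftrightarrow> summable (\<lambda>n. of_real (run_pmf r P X i n) * z ^ n)"

definition run_pgf ::
  "('a \<Rightarrow> 'a \<Rightarrow> bool) \<Rightarrow> 'w measure \<Rightarrow> (nat \<Rightarrow> 'w \<Rightarrow> 'a) \<Rightarrow> nat \<Rightarrow> complex \<Rightarrow> complex" where
  "run_pgf r P X i z = (\<Sum>n. of_real (run_pmf r P X i n) * z ^ n)"

end

theory Submission
  imports Defs
begin

text \<open>
  Let \<open>c\<^sub>n = P(X\<^sub>0 r X\<^sub>1 r \<dots> r X\<^bsub>n-1\<^esub>)\<close> with generating function \<open>C\<close>. Then
  \<open>P(N\<^sub>0 = n) = c\<^sub>n - c\<^bsub>n+1\<^esub>\<close>, and for \<open>i \<ge> 1\<close> the event \<open>S\<^sub>i \<inter> {N\<^sub>i = n}\<close> has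
  probability \<open>c\<^sub>n - 2 c\<^bsub>n+1\<^esub> + c\<^bsub>n+2\<^esub>\<close>, so both generating functions are elementary in \<open>C\<close>.

  In the strict case exchangeability gives \<open>n! c\<^sub>n = P(X\<^sub>0, \<dots>, X\<^bsub>n-1\<^esub> distinct)\<close>. Forbidding the
  value of one atom \<open>\<alpha>\<close> removes the factor \<open>1 + m\<^sub>\<alpha> z\<close> from \<open>C(z)\<close>. After all atoms of a finite set \<open>F\<close> are
  removed, coincidences have probability tending to 0 along \<open>F\<close>, so what remains tends to
  \<open>exp (m\<^sub>d z)\<close>. This yields convergence of the product and its value together. The
  non-strict case follows from the reciprocity \<open>C\<^sub>\<le>(z) C\<^sub><(-z) = 1\<close>.
\<close>

section \<open>Auxiliary facts on unordered sums of measures, differences of events and unordered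
  products\<close>

lemma (in finite_measure) has_sum_measure_UN:
  assumes "countable A" "disjoint_family_on F A" "\<And>i. i \<in> A \<Longrightarrow> F i \<in> sets M"
  shows "((\<lambda>i. measure M (F i)) has_sum measure M (\<Union>i\<in>A. F i)) A"
proof (cases "finite A")
  case True
  then show ?thesis
    using assms by (intro has_sum_finiteI finite_measure_finite_Union) auto
next
  case False
  \<comment> \<open>An enumeration of \<open>A\<close> reduces the claim to countable additivity
    over \<open>nat\<close>; nonnegativity of the terms then makes the convergence independent of
    the order.\<close>
  let ?e = "from_nat_into A"
  have bij: "bij_betw ?e UNIV A"
    using assms(1) False by (rule bij_betw_from_nat_into)
  have e: "?e n \<in> A" for n
    using bij by (auto simp: bij_betw_def)
  have "disjoint_family (\<lambda>n. F (?e n))"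
    using assms(2) bij unfolding disjoint_family_on_def bij_betw_def inj_on_def by blast
  then have "(\<lambda>n. measure M (F (?e n))) sums measure M (\<Union>n. F (?e n))"
    using assms(3) e by (intro finite_measure_UNION) auto
  then have "((\<lambda>n. measure M (F (?e n))) has_sum measure M (\<Union>n. F (?e n))) UNIV"
    by (rule sums_nonneg_imp_has_sum) simp
  moreover have "(\<Union>n. F (?e n)) = (\<Union>i\<in>A. F i)"
    using bij by (metis bij_betw_def image_image)
  ultimately show ?thesis
    by (simp add: has_sum_reindex_bij_betw[OF bij, symmetric])
qed

lemma (in prob_space) prob_conj_not:
  assumes [measurable]: "Measurable.pred M A" "Measurable.pred M B"
    and "\<And>x. x \<in> space M \<Longrightarrow> B x \<Longrightarrow> A x"
  shows "\<P>(x in M. A x \<and> \<not> B x) = \<P>(x in M. A x) - \<P>(x in M. B x)"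
proof -
  have "{x \<in> space M. A x \<and> \<not> B x} = {x \<in> space M. A x} - {x \<in> space M. B x}"
    by auto
  then show ?thesis
    using assms(3) by (simp only:) (rule finite_measure_Diff, auto)
qed

text \<open>A single limit along finite subsets settles both existence and value, so no separate
  convergence criterion for the product is ever invoked.\<close>

lemma infprod_eqI:
  assumes "(prod f \<longlongrightarrow> p) (finite_subsets_at_top A)"
  shows "prod_convergent_on f A" "infprod f A = p"
  using assms by (auto simp: prod_convergent_on_def infprod_def intro!: tendsto_Lim)

text \<open>The chain starts at \<open>x i\<close> and has \<open>n\<close> members, hence \<open>n - 1\<close> links (none for \<open>n = 0\<close>).\<close>

definition chain :: "('a \<Rightarrow> 'a \<Rightarrow> bool) \<Rightarrow> (nat \<Rightarrow> 'a) \<Rightarrow> nat \<Rightarrow> nat \<Rightarrow> bool" where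
  "chain r x i n \<longleftrightarrow> (\<forall>j < n - 1. r (x (i + j)) (x (Suc (i + j))))"

lemma chain_0 [simp]: "chain r x i 0" and chain_Suc_0 [simp]: "chain r x i (Suc 0)"
  by (simp_all add: chain_def)

text \<open>Adding a member at the end adds one link, except that passing from 0 to 1 members adds
  none; \<open>0 < n\<close> excludes that case.\<close>

lemma chain_Suc:
  "0 < n \<Longrightarrow> chain r x i (Suc n) \<longleftrightarrow> chain r x i n \<and> r (x (i + n - 1)) (x (i + n))"
  by (cases n) (auto simp: chain_def less_Suc_eq)

lemma chain_Suc':
  "0 < n \<Longrightarrow> chain r x i (Suc n) \<longleftrightarrow> r (x i) (x (Suc i)) \<and> chain r x (Suc i) n"
  by (cases n) (simp_all add: chain_def All_less_Suc2)

lemma finite_run_iff_chain: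
  "finite_run r x i n \<longleftrightarrow> 0 < n \<and> chain r x i n \<and> \<not> chain r x i (Suc n)"
proof (cases "n = 0")
  case False
  have "(\<forall>j. i \<le> j \<and> j < i + n - 1 \<longrightarrow> r (x j) (x (j + 1))) \<longleftrightarrow> chain r x i n"
  proof
    assume *: "\<forall>j. i \<le> j \<and> j < i + n - 1 \<longrightarrow> r (x j) (x (j + 1))"
    show "chain r x i n"
      unfolding chain_def
    proof (intro allI impI)
      fix j assume "j < n - 1"
      then show "r (x (i + j)) (x (Suc (i + j)))"
        using *[rule_format, of "i + j"] by simp
    qed
  next
    assume *: "chain r x i n"
    show "\<forall>j. i \<le> j \<and> j < i + n - 1 \<longrightarrow> r (x j) (x (j + 1))"
    proof (intro allI impI)
      fix j assume j: "i \<le> j \<and> j < i + n - 1"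
      then have "j - i < n - 1"
        by linarith
      with j show "r (x j) (x (j + 1))"
        using *[unfolded chain_def, rule_format, of "j - i"] by simp
    qed
  qed
  with False show ?thesis
    by (auto simp: finite_run_def chain_Suc)
qed (simp add: finite_run_def)

subsection \<open>Symmetry and independence of an i.i.d. sequence\<close>

locale iid_sequence = prob_space P for P :: "'w measure" +
  fixes M :: "'a::linorder measure" and X :: "nat \<Rightarrow> 'w \<Rightarrow> 'a"
  assumes prob_space_M: "prob_space M"
    and less_measurable:
      "{(x, y). x \<in> space M \<and> y \<in> space M \<and> x < y} \<in> sets (M \<Otimes>\<^sub>M M)"
    and indep_X: "indep_vars (\<lambda>_. M) X UNIV"
    and distr_X: "\<And>i. distr P M (X i) = M"
begin

sublocale M: prob_space M
  by (rule prob_space_M)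

lemma measurable_X [measurable]: "X i \<in> measurable P M"
  using indep_X by (auto simp: indep_vars_def)

lemma X_in_space: "\<omega> \<in> space P \<Longrightarrow> X i \<omega> \<in> space M"
  using measurable_X by (rule measurable_space)

text \<open>Kept abstract in \<open>r\<close> so that \<open>(<)\<close>, \<open>(\<le>)\<close>,
  their complements and their converses are all instances of the same chain lemmas.\<close>

definition measurable_rel :: "('a \<Rightarrow> 'a \<Rightarrow> bool) \<Rightarrow> bool" where
  "measurable_rel r \<longleftrightarrow> Measurable.pred (M \<Otimes>\<^sub>M M) (\<lambda>p. r (fst p) (snd p))"

lemma pred_rel:
  assumes "measurable_rel r" "f \<in> measurable N M" "g \<in> measurable N M"
  shows "Measurable.pred N (\<lambda>w. r (f w) (g w))"
proof -
  have "(\<lambda>w. (f w, g w)) \<in> measurable N (M \<Otimes>\<^sub>M M)"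
    using assms by simp
  from measurable_compose[OF this assms(1)[unfolded measurable_rel_def]]
  show ?thesis by simp
qed

lemma measurable_rel_less: "measurable_rel (<)"
proof -
  have "{p \<in> space (M \<Otimes>\<^sub>M M). fst p < snd p}
        = {(x, y). x \<in> space M \<and> y \<in> space M \<and> x < y}"
    by (auto simp: space_pair_measure)
  then show ?thesis
    using less_measurable by (simp add: measurable_rel_def pred_def)
qed

lemma measurable_rel_compl: "measurable_rel r \<Longrightarrow> measurable_rel (\<lambda>x y. \<not> r x y)"
  unfolding measurable_rel_def by measurable

lemma measurable_rel_flip: "measurable_rel r \<Longrightarrow> measurable_rel (\<lambda>x y. r y x)"
  unfolding measurable_rel_def[of "\<lambda>x y. r y x"] by (rule pred_rel) auto

lemma measurable_rel_greater: "measurable_rel (>)"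
  using measurable_rel_flip[OF measurable_rel_less] .

lemma measurable_rel_le: "measurable_rel (\<le>)"
  using measurable_rel_compl[OF measurable_rel_greater] by (simp add: not_less)

lemmas pred_less [measurable] = pred_rel[OF measurable_rel_less]
lemmas pred_le [measurable] = pred_rel[OF measurable_rel_le]

text \<open>By antisymmetry the diagonal is the intersection of two order relations, hence
  measurable; its sections give the singletons.\<close>

lemma pred_eq [measurable]:
  assumes [measurable]: "f \<in> measurable N M" "g \<in> measurable N M"
  shows "Measurable.pred N (\<lambda>w. f w = g w)"
  unfolding eq_iff[of "f _"] by measurable

lemma singleton_sets [measurable]: "{a} \<in> sets M"  if "a \<in> space M" for a
proof -
  have "Measurable.pred M (\<lambda>x. x = a)"
    using that by measurable
  then show ?thesis
    using that by (simp add: pred_def Collect_conv_if)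
qed

text \<open>Independence makes the joint law a product of identical factors, and such a product does
  not change when coordinates are selected injectively. Shifts (stationarity) and permutations
  (exchangeability) are both special cases.\<close>

lemma distr_PiM: "inj \<pi> \<Longrightarrow> distr P (\<Pi>\<^sub>M i\<in>UNIV. M) (\<lambda>\<omega> i. X (\<pi> i) \<omega>) = (\<Pi>\<^sub>M i\<in>UNIV. M)"
proof -
  assume "inj \<pi>"
  have *: "distr P (\<Pi>\<^sub>M i\<in>UNIV. M) (\<lambda>\<omega> i. X i \<omega>) = (\<Pi>\<^sub>M i\<in>UNIV. M)"
    using indep_vars_iff_distr_eq_PiM[where I = UNIV and M' = "\<lambda>_. M" and X = X] indep_X
    by (simp add: distr_X restrict_UNIV)
  have "distr P (\<Pi>\<^sub>M i\<in>UNIV. M) (\<lambda>\<omega> i. X (\<pi> i) \<omega>)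
      = distr (distr P (\<Pi>\<^sub>M i\<in>UNIV. M) (\<lambda>\<omega> i. X i \<omega>)) (\<Pi>\<^sub>M i\<in>UNIV. M) (\<lambda>x i. x (\<pi> i))"
    by (subst distr_distr)
      (auto intro!: measurable_PiM_single' simp: comp_def space_PiM PiE_UNIV_domain X_in_space Pi_iff)
  also have "\<dots> = (\<Pi>\<^sub>M i\<in>UNIV. M)"
    unfolding * using distr_PiM_reindex[of UNIV "\<lambda>_. M" \<pi> UNIV] \<open>inj \<pi>\<close>
    by (simp add: prob_space_M restrict_UNIV)
  finally show ?thesis .
qed

lemma prob_reindex:
  assumes "inj \<pi>" "Measurable.pred (\<Pi>\<^sub>M i\<in>UNIV. M) Q"
  shows "\<P>(\<omega> in P. Q (\<lambda>i. X (\<pi> i) \<omega>)) = \<P>(\<omega> in P. Q (\<lambda>i. X i \<omega>))"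
proof -
  have *: "\<P>(\<omega> in P. Q (\<lambda>i. X (\<rho> i) \<omega>)) = measure (\<Pi>\<^sub>M i\<in>UNIV. M) {x \<in> space (\<Pi>\<^sub>M i\<in>UNIV. M). Q x}"
    if "inj \<rho>" for \<rho>
  proof -
    have m: "(\<lambda>\<omega> i. X (\<rho> i) \<omega>) \<in> measurable P (\<Pi>\<^sub>M i\<in>UNIV. M)"
      by (auto intro!: measurable_PiM_single' simp: space_PiM dest: X_in_space)
    have "measure (\<Pi>\<^sub>M i\<in>UNIV. M) {x \<in> space (\<Pi>\<^sub>M i\<in>UNIV. M). Q x}
      = measure (distr P (\<Pi>\<^sub>M i\<in>UNIV. M) (\<lambda>\<omega> i. X (\<rho> i) \<omega>)) {x \<in> space (\<Pi>\<^sub>M i\<in>UNIV. M). Q x}"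
      unfolding distr_PiM[OF that] ..
    also have "\<dots> = \<P>(\<omega> in P. Q (\<lambda>i. X (\<rho> i) \<omega>))"
      using assms(2) by (subst measure_distr[OF m])
        (auto intro!: arg_cong[where f=prob] measurable_space[OF m] simp: pred_def)
    finally show ?thesis ..
  qed
  show ?thesis
    using *[OF assms(1)] *[of "\<lambda>i. i"] by simp
qed

text \<open>Independence of two blocks of variables. The restrictions to \<open>I\<close> and
  \<open>J\<close> record that each event looks only at its own block.\<close>

lemma prob_indep_conj:
  assumes "I \<inter> J = {}" "Measurable.pred (\<Pi>\<^sub>M i\<in>I. M) Q" "Measurable.pred (\<Pi>\<^sub>M i\<in>J. M) R"
  shows "\<P>(\<omega> in P. Q (\<lambda>i\<in>I. X i \<omega>) \<and> R (\<lambda>i\<in>J. X i \<omega>))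
       = \<P>(\<omega> in P. Q (\<lambda>i\<in>I. X i \<omega>)) * \<P>(\<omega> in P. R (\<lambda>i\<in>J. X i \<omega>))"
proof -
  have sp: "(\<lambda>i\<in>K. X i \<omega>) \<in> space (\<Pi>\<^sub>M i\<in>K. M)" if "\<omega> \<in> space P" for \<omega> K
    using X_in_space[OF that] by (auto simp: space_PiM)
  have "indep_var (\<Pi>\<^sub>M i\<in>I. M) (\<lambda>\<omega>. \<lambda>i\<in>I. X i \<omega>) (\<Pi>\<^sub>M i\<in>J. M) (\<lambda>\<omega>. \<lambda>i\<in>J. X i \<omega>)"
    using indep_X assms(1) by (rule indep_var_restrict) auto
  from indep_varD[OF this, of "{x \<in> space (\<Pi>\<^sub>M i\<in>I. M). Q x}" "{x \<in> space (\<Pi>\<^sub>M i\<in>J. M). R x}"]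
  show ?thesis
    using assms(2,3) sp by (simp add: pred_def vimage_def Int_def conj_commute cong: conj_cong)
qed

subsection \<open>Run lengths and monotone chains\<close>

definition chain_prob :: "('a \<Rightarrow> 'a \<Rightarrow> bool) \<Rightarrow> nat \<Rightarrow> real" where
  "chain_prob r n = \<P>(\<omega> in P. chain r (\<lambda>j. X j \<omega>) 0 n)"

lemma chain_prob_0 [simp]: "chain_prob r 0 = 1"
  and chain_prob_Suc_0 [simp]: "chain_prob r (Suc 0) = 1"
  by (simp_all add: chain_prob_def prob_space)

lemma chain_prob_nonneg: "0 \<le> chain_prob r n"
  by (simp add: chain_prob_def)

lemma pred_chain:
  assumes "measurable_rel r" "\<And>j. i \<le> j \<Longrightarrow> j < i + n \<Longrightarrow> f j \<in> measurable N M"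
  shows "Measurable.pred N (\<lambda>w. chain r (\<lambda>j. f j w) i n)"
proof -
  have "Measurable.pred N (\<lambda>w. \<forall>j\<in>{..<n - 1}. r (f (i + j) w) (f (Suc (i + j)) w))"
    using assms(2) by (intro pred_intros_finite pred_rel[OF assms(1)]) auto
  then show ?thesis
    by (simp only: chain_def Ball_def lessThan_iff)
qed

lemma prob_chain:
  assumes "measurable_rel r"
  shows "\<P>(\<omega> in P. chain r (\<lambda>j. X j \<omega>) i n) = chain_prob r n"
proof -
  have "Measurable.pred (\<Pi>\<^sub>M i\<in>UNIV. M) (\<lambda>x. chain r x 0 n)"
    by (rule pred_chain[OF assms]) simp
  from prob_reindex[OF _ this, of "(+) i"] show ?thesis
    by (simp add: chain_prob_def) (simp add: chain_def)
qed

lemma run_pmf_0: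
  assumes "measurable_rel r"
  shows "run_pmf r P X 0 n = chain_prob r n - chain_prob r (Suc n)"
proof (cases n)
  \<comment> \<open>No run has length 0, and the right-hand side agrees because chains with 0 and
    with 1 member both have probability 1.\<close>
  case 0
  then show ?thesis
    by (simp add: run_pmf_def cond_prob_def run_length_eq_enat_iff finite_run_iff_chain)
next
  case (Suc m)
  note [measurable] = pred_chain[where f = X and N = P, OF assms measurable_X] pred_rel[OF assms]
  have "{\<omega> \<in> space P. \<omega> \<in> run_begins r P X 0} = space P"
    by (auto simp: run_begins_def)
  moreover have "\<P>(\<omega> in P. run_length r X 0 \<omega> = enat n \<and> \<omega> \<in> run_begins r P X 0)
      = \<P>(\<omega> in P. chain r (\<lambda>j. X j \<omega>) 0 n \<and> \<not> chain r (\<lambda>j. X j \<omega>) 0 (Suc n))"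
    using Suc by (intro arg_cong[where f = prob])
      (auto simp: run_length_eq_enat_iff finite_run_iff_chain run_begins_def)
  moreover have "\<dots> = chain_prob r n - chain_prob r (Suc n)"
    using Suc unfolding chain_prob_def by (intro prob_conj_not) (auto simp: chain_Suc)
  ultimately show ?thesis
    by (simp add: run_pmf_def cond_prob_def prob_space)
qed

text \<open>A maximal chain of \<open>n\<close> members from \<open>Suc i\<close> begins a run
  unless the link from \<open>i\<close> also holds, and then it is part of a maximal chain of
  \<open>n + 1\<close> members from \<open>i\<close>. Subtracting the two probabilities gives a
  second difference, and \<open>1 - chain_prob r 2\<close> is the probability that the link from
  \<open>i\<close> is broken. At \<open>n = 0\<close> the quotient equals -1 although the
  probability is 0; the last summand corrects this and later becomes the leading 1 of the generating
  function.\<close>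

lemma run_pmf_Suc:
  assumes "measurable_rel r" and "chain_prob r 2 \<noteq> 1"
  shows "run_pmf r P X (Suc i) n =
    (chain_prob r n - 2 * chain_prob r (Suc n) + chain_prob r (Suc (Suc n))) / (1 - chain_prob r 2)
      + (if n = 0 then 1 else 0)"
proof (cases n)
  case 0
  then show ?thesis
    using assms(2)
    by (simp add: run_pmf_def cond_prob_def run_length_eq_enat_iff finite_run_iff_chain
        numeral_2_eq_2 divide_simps)
next
  case (Suc m)
  note [measurable] = pred_chain[where f = X and N = P, OF assms(1) measurable_X] pred_rel[OF assms(1)]
  let ?c = "\<lambda>\<omega>. chain r (\<lambda>j. X j \<omega>)"
  have "\<P>(\<omega> in P. \<omega> \<in> run_begins r P X (Suc i)) = \<P>(\<omega> in P. True \<and> \<not> ?c \<omega> i 2)"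
    by (intro arg_cong[where f = prob]) (auto simp: run_begins_def chain_Suc numeral_2_eq_2)
  also have "\<dots> = \<P>(\<omega> in P. True) - \<P>(\<omega> in P. ?c \<omega> i 2)"
    by (rule prob_conj_not) auto
  finally have begins: "\<P>(\<omega> in P. \<omega> \<in> run_begins r P X (Suc i)) = 1 - chain_prob r 2"
    by (simp add: prob_chain[OF assms(1)] prob_space)
  have "\<P>(\<omega> in P. run_length r X (Suc i) \<omega> = enat n \<and> \<omega> \<in> run_begins r P X (Suc i))
      = \<P>(\<omega> in P. (?c \<omega> (Suc i) n \<and> \<not> ?c \<omega> (Suc i) (Suc n))
                 \<and> \<not> (?c \<omega> i (Suc n) \<and> \<not> ?c \<omega> i (Suc (Suc n))))"
    using Suc by (intro arg_cong[where f = prob])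
      (auto simp: run_length_eq_enat_iff finite_run_iff_chain run_begins_def chain_Suc')
  also have "\<dots> = \<P>(\<omega> in P. ?c \<omega> (Suc i) n \<and> \<not> ?c \<omega> (Suc i) (Suc n))
      - \<P>(\<omega> in P. ?c \<omega> i (Suc n) \<and> \<not> ?c \<omega> i (Suc (Suc n)))"
    using Suc by (intro prob_conj_not) (auto simp: chain_Suc')
  also have "\<P>(\<omega> in P. ?c \<omega> (Suc i) n \<and> \<not> ?c \<omega> (Suc i) (Suc n))
      = chain_prob r n - chain_prob r (Suc n)"
    using Suc unfolding prob_chain[OF assms(1), symmetric, of _ "Suc i"]
    by (intro prob_conj_not) (auto simp: chain_Suc)
  also have "\<P>(\<omega> in P. ?c \<omega> i (Suc n) \<and> \<not> ?c \<omega> i (Suc (Suc n)))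
      = chain_prob r (Suc n) - chain_prob r (Suc (Suc n))"
    using Suc unfolding prob_chain[OF assms(1), symmetric, of _ i]
    by (intro prob_conj_not) (auto simp: chain_Suc)
  finally show ?thesis
    using Suc begins by (simp add: run_pmf_def cond_prob_def)
qed

section \<open>Generating functions of chains and of runs\<close>

definition chain_gf :: "('a \<Rightarrow> 'a \<Rightarrow> bool) \<Rightarrow> complex \<Rightarrow> complex" where
  "chain_gf r z = (\<Sum>n. of_real (chain_prob r n) * z ^ n)"

text \<open>The first two terms of the series are 1 and \<open>z\<close>; dropping them and dividing
  by the power of \<open>z\<close> shifts the coefficients.\<close>

lemma chain_prob_shift_sums:
  assumes "summable (\<lambda>n. of_real (chain_prob r n) * z ^ n)" and z: "z \<noteq> 0"
  shows "(\<lambda>n. of_real (chain_prob r (Suc n)) * z ^ n) sums ((chain_gf r z - 1) / z)"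
    and "(\<lambda>n. of_real (chain_prob r (Suc (Suc n))) * z ^ n) sums ((chain_gf r z - 1 - z) / z\<^sup>2)"
proof -
  let ?f = "\<lambda>n. complex_of_real (chain_prob r n) * z ^ n"
  have f: "?f sums chain_gf r z"
    using assms(1) by (simp add: chain_gf_def summable_sums)
  then have f1: "(\<lambda>n. ?f (Suc n)) sums (chain_gf r z - 1)"
    by (subst sums_Suc_iff) simp
  then have f2: "(\<lambda>n. ?f (Suc (Suc n))) sums (chain_gf r z - 1 - z)"
    by (subst sums_Suc_iff) simp
  show "(\<lambda>n. of_real (chain_prob r (Suc n)) * z ^ n) sums ((chain_gf r z - 1) / z)"
    using sums_divide[OF f1, of z] z by simp
  show "(\<lambda>n. of_real (chain_prob r (Suc (Suc n))) * z ^ n) sums ((chain_gf r z - 1 - z) / z\<^sup>2)"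
    using sums_divide[OF f2, of "z\<^sup>2"] z by (simp add: power2_eq_square)
qed

lemma run_pgf_0_sums:
  assumes "measurable_rel r" "summable (\<lambda>n. of_real (chain_prob r n) * z ^ n)" and z: "z \<noteq> 0"
  shows "(\<lambda>n. of_real (run_pmf r P X 0 n) * z ^ n) sums (1 / z * (1 + (z - 1) * chain_gf r z))"
proof -
  have "(\<lambda>n. of_real (chain_prob r n) * z ^ n - of_real (chain_prob r (Suc n)) * z ^ n)
      sums (chain_gf r z - (chain_gf r z - 1) / z)"
    by (intro sums_diff chain_prob_shift_sums assms)
      (use assms(2) in \<open>simp add: chain_gf_def summable_sums\<close>)
  moreover have "chain_gf r z - (chain_gf r z - 1) / z = 1 / z * (1 + (z - 1) * chain_gf r z)"
    using z by (simp add: field_simps)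
  ultimately show ?thesis
    by (simp add: run_pmf_0[OF assms(1)] left_diff_distrib)
qed

lemma run_pgf_Suc_sums:
  assumes "measurable_rel r" "summable (\<lambda>n. of_real (chain_prob r n) * z ^ n)" and z: "z \<noteq> 0"
    and "chain_prob r 2 \<noteq> 1"
  shows "(\<lambda>n. of_real (run_pmf r P X (Suc i) n) * z ^ n) sums
    (1 + (z - 1) / (z * (1 - of_real (chain_prob r 2))) * run_pgf r P X 0 z)"
proof -
  let ?C = "chain_gf r z" and ?d = "1 - complex_of_real (chain_prob r 2)"
  have d: "?d \<noteq> 0"
    using assms(4) by (metis eq_iff_diff_eq_0 of_real_eq_1_iff)
  have pgf: "run_pgf r P X 0 z = 1 / z * (1 + (z - 1) * ?C)"
    using run_pgf_0_sums[OF assms(1-3)] by (simp add: run_pgf_def sums_iff)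
  have "(\<lambda>n. (of_real (chain_prob r n) * z ^ n - 2 * (of_real (chain_prob r (Suc n)) * z ^ n)
        + of_real (chain_prob r (Suc (Suc n))) * z ^ n) / ?d + (if n = 0 then 1 else 0))
      sums ((?C - 2 * ((?C - 1) / z) + (?C - 1 - z) / z\<^sup>2) / ?d + 1)"
    by (intro sums_add sums_divide sums_diff sums_mult chain_prob_shift_sums assms sums_single)
      (use assms(2) in \<open>simp add: chain_gf_def summable_sums\<close>)
  \<comment> \<open>The second difference factors as \<open>(z - 1) * (1 + (z - 1) * ?C)\<close>
    over the square of \<open>z\<close>, which is \<open>(z - 1) / z\<close> times the generating
    function at index 0.\<close>
  moreover have "(?C - 2 * ((?C - 1) / z) + (?C - 1 - z) / z\<^sup>2) / ?d + 1
      = 1 + (z - 1) / (z * ?d) * run_pgf r P X 0 z"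
    unfolding pgf using z d by (simp add: field_simps power2_eq_square)
  moreover have "of_real (run_pmf r P X (Suc i) n) * z ^ n =
      (of_real (chain_prob r n) * z ^ n - 2 * (of_real (chain_prob r (Suc n)) * z ^ n)
        + of_real (chain_prob r (Suc (Suc n))) * z ^ n) / ?d + (if n = 0 then 1 else 0)" for n
    by (auto simp: run_pmf_Suc[OF assms(1,4)] ring_distribs add_divide_distrib diff_divide_distrib)
  ultimately show ?thesis
    by (simp only:)
qed

subsection \<open>Distinct values\<close>

text \<open>The set \<open>S\<close> of admissible values is a parameter so that atoms can be
  forbidden one after another; the index set is arbitrary so that a single index can be taken
  out.\<close>

definition distinct_prob :: "nat set \<Rightarrow> 'a set \<Rightarrow> real" where
  "distinct_prob I S = \<P>(\<omega> in P. (\<forall>i\<in>I. X i \<omega> \<in> S) \<and> inj_on (\<lambda>i. X i \<omega>) I)"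

lemma pred_distinct:
  assumes "finite I" and [measurable]: "S \<in> sets M" and f: "\<And>i. i \<in> I \<Longrightarrow> f i \<in> measurable N M"
  shows "Measurable.pred N (\<lambda>w. (\<forall>i\<in>I. f i w \<in> S) \<and> inj_on (\<lambda>i. f i w) I)"
  unfolding inj_on_def using assms(1) f
  by (intro pred_intros_logic pred_intros_finite pred_eq pred_sets2[OF assms(2)]) auto

lemma distinct_prob_nonneg: "0 \<le> distinct_prob I S"
  and distinct_prob_le_1: "distinct_prob I S \<le> 1"
  by (simp_all add: distinct_prob_def)

lemma distinct_prob_empty [simp]: "distinct_prob {} S = 1"
  by (simp add: distinct_prob_def prob_space)

lemma distinct_prob_reindex:
  assumes "inj \<pi>" "finite I" "S \<in> sets M"
  shows "distinct_prob (\<pi> ` I) S = distinct_prob I S"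
proof -
  have "Measurable.pred (\<Pi>\<^sub>M i\<in>UNIV. M) (\<lambda>x. (\<forall>i\<in>I. x i \<in> S) \<and> inj_on x I)"
    using pred_distinct[OF assms(2,3), of "\<lambda>i x. x i" "\<Pi>\<^sub>M i\<in>UNIV. M"] by simp
  from prob_reindex[OF assms(1) this]
  have "\<P>(\<omega> in P. (\<forall>i\<in>I. X (\<pi> i) \<omega> \<in> S) \<and> inj_on (\<lambda>i. X (\<pi> i) \<omega>) I) = distinct_prob I S"
    by (simp add: distinct_prob_def)
  moreover have "inj_on (\<lambda>i. X i \<omega>) (\<pi> ` I) \<longleftrightarrow> inj_on (\<lambda>i. X (\<pi> i) \<omega>) I" for \<omega>
    using comp_inj_on_iff[of \<pi> I "\<lambda>i. X i \<omega>"] inj_on_subset[OF assms(1)] by (simp add: comp_def)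
  ultimately show ?thesis
    by (simp add: distinct_prob_def)
qed

lemma prob_X_in:
  assumes "A \<in> sets M"
  shows "\<P>(\<omega> in P. X i \<omega> \<in> A) = measure M A"
proof -
  have "measure M A = measure (distr P M (X i)) A"
    by (simp add: distr_X)
  also have "\<dots> = \<P>(\<omega> in P. X i \<omega> \<in> A)"
    using assms by (subst measure_distr) (auto intro!: arg_cong[where f = prob])
  finally show ?thesis ..
qed

text \<open>Among \<open>n + 1\<close> distinct values at most one is \<alpha>. Either none is
  (\<open>E'\<close>), or exactly one index \<open>j\<close> carries it (\<open>E j\<close>). By
  independence and exchangeability each of the \<open>n + 1\<close> disjoint events
  \<open>E j\<close> has the same probability, the mass of \<alpha> times the probability for the
  \<open>n\<close> other indices.\<close>

lemma distinct_prob_remove_point: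
  assumes S [measurable]: "S \<in> sets M" and \<alpha>: "\<alpha> \<in> S"
  shows "distinct_prob {..<Suc n} S = distinct_prob {..<Suc n} (S - {\<alpha>})
       + real (Suc n) * measure M {\<alpha>} * distinct_prob {..<n} (S - {\<alpha>})"
proof -
  have \<alpha>_space: "\<alpha> \<in> space M"
    using S \<alpha> sets.sets_into_space by blast
  note [measurable] = singleton_sets[OF \<alpha>_space]
  let ?D = "\<lambda>I S \<omega>. (\<forall>i\<in>I. X i \<omega> \<in> S) \<and> inj_on (\<lambda>i. X i \<omega>) I"
  define E where "E j = {\<omega> \<in> space P. X j \<omega> \<in> {\<alpha>} \<and> ?D ({..<Suc n} - {j}) (S - {\<alpha>}) \<omega>}" for j
  define E' where "E' = {\<omega> \<in> space P. ?D {..<Suc n} (S - {\<alpha>}) \<omega>}"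
  have pred_D: "Measurable.pred P (?D I (S - {\<alpha>}))" if "finite I" for I
    using that by (intro pred_distinct) auto
  have sets: "E j \<in> events" "E' \<in> events" for j
  proof -
    have "Measurable.pred P (\<lambda>\<omega>. X j \<omega> \<in> {\<alpha>})"
      by measurable
    then show "E j \<in> events" "E' \<in> events"
      using pred_D[of "{..<Suc n} - {j}"] pred_D[of "{..<Suc n}"]
      unfolding E_def E'_def by (simp_all only: pred_def[symmetric] pred_intros_logic finite_Diff finite_lessThan)
  qed
  have prob_E: "prob (E j) = measure M {\<alpha>} * distinct_prob {..<n} (S - {\<alpha>})" if j: "j < Suc n" for j
  proof -
    let ?J = "{..<Suc n} - {j}"
    have "prob (E j) = \<P>(\<omega> in P. X j \<omega> \<in> {\<alpha>}) * distinct_prob ?J (S - {\<alpha>})"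
    proof -
      have 1: "Measurable.pred (\<Pi>\<^sub>M i\<in>{j}. M) (\<lambda>x. x j \<in> {\<alpha>})"
        by measurable
      have 2: "Measurable.pred (\<Pi>\<^sub>M i\<in>?J. M) (\<lambda>x. (\<forall>i\<in>?J. x i \<in> S - {\<alpha>}) \<and> inj_on x ?J)"
        using pred_distinct[of ?J "S - {\<alpha>}" "\<lambda>i x. x i" "\<Pi>\<^sub>M i\<in>?J. M"] by simp
      have 3: "(\<lambda>i\<in>{j}. X i \<omega>) j = X j \<omega>"
        "(\<forall>i\<in>?J. (\<lambda>i\<in>?J. X i \<omega>) i \<in> S - {\<alpha>}) \<longleftrightarrow> (\<forall>i\<in>?J. X i \<omega> \<in> S - {\<alpha>})"
        "inj_on (\<lambda>i\<in>?J. X i \<omega>) ?J \<longleftrightarrow> inj_on (\<lambda>i. X i \<omega>) ?J" for \<omega>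
        by (simp, simp, intro inj_on_cong, simp)
      have "{j} \<inter> ?J = {}"
        by simp
      from prob_indep_conj[OF this 1 2] show ?thesis
        unfolding 3 E_def distinct_prob_def .
    qed
    \<comment> \<open>Skipping \<open>j\<close> renumbers the other indices as
      \<open>{..<n}\<close>; the map is injective on all of \<open>nat\<close>, as the reindexing
      lemma requires.\<close>
    also have "?J = (\<lambda>i. if i < j then i else Suc i) ` {..<n}"
    proof
      show "?J \<subseteq> (\<lambda>i. if i < j then i else Suc i) ` {..<n}"
      proof
        fix i assume "i \<in> ?J"
        then show "i \<in> (\<lambda>i. if i < j then i else Suc i) ` {..<n}"
          using j by (intro image_eqI[of _ _ "if i < j then i else i - 1"]) auto
      qed
    qed (use j in auto)
    also have "distinct_prob \<dots> (S - {\<alpha>}) = distinct_prob {..<n} (S - {\<alpha>})"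
      by (rule distinct_prob_reindex) (auto simp: inj_def)
    finally show ?thesis
      by (simp only: prob_X_in[OF singleton_sets[OF \<alpha>_space]])
  qed
  have E_disj: "disjoint_family_on E {..<Suc n}"
    by (auto simp: disjoint_family_on_def E_def)
  have eq: "{\<omega> \<in> space P. ?D {..<Suc n} S \<omega>} = E' \<union> (\<Union>j<Suc n. E j)" (is "?L = ?R")
  proof
    show "?L \<subseteq> ?R"
    proof
      fix \<omega> assume \<omega>: "\<omega> \<in> ?L"
      show "\<omega> \<in> ?R"
      proof (cases "\<exists>j<Suc n. X j \<omega> = \<alpha>")
        case True
        then obtain j where j: "j < Suc n" "X j \<omega> = \<alpha>"
          by blast
        with \<omega> have "\<omega> \<in> E j"
          by (auto simp: E_def inj_on_def)
        with j show ?thesis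
          by blast
      next
        case False
        with \<omega> show ?thesis
          by (auto simp: E'_def)
      qed
    qed
    show "?R \<subseteq> ?L"
    proof -
      have "?D {..<Suc n} S \<omega>" if "\<omega> \<in> E j" "j < Suc n" for \<omega> j
      proof -
        have "X j \<omega> = \<alpha>" "\<forall>i\<in>{..<Suc n} - {j}. X i \<omega> \<in> S - {\<alpha>}" "inj_on (\<lambda>i. X i \<omega>) ({..<Suc n} - {j})"
          using that(1) by (auto simp: E_def)
        moreover from this have "inj_on (\<lambda>i. X i \<omega>) (insert j ({..<Suc n} - {j}))"
          unfolding inj_on_insert by auto
        ultimately show ?thesis
          using that(2) \<alpha> by (auto simp: insert_absorb)
      qed
      then show ?thesis
        by (auto simp: E'_def E_def)
    qed
  qed
  have "distinct_prob {..<Suc n} S = prob (E' \<union> (\<Union>j<Suc n. E j))"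
    by (simp only: distinct_prob_def eq)
  also have "\<dots> = prob E' + prob (\<Union>j<Suc n. E j)"
    using sets by (intro finite_measure_Union) (auto simp: E_def E'_def)
  also have "prob (\<Union>j<Suc n. E j) = (\<Sum>j<Suc n. prob (E j))"
    using sets E_disj by (intro finite_measure_finite_Union) auto
  also have "prob E' = distinct_prob {..<Suc n} (S - {\<alpha>})"
    by (simp add: E'_def distinct_prob_def)
  finally show ?thesis
    by (simp add: prob_E)
qed

section \<open>Distinctness compared with mere membership, up to coincidences\<close>

lemma prob_all_X_in:
  assumes [measurable]: "S \<in> sets M"
  shows "\<P>(\<omega> in P. \<forall>i<n. X i \<omega> \<in> S) = measure M S ^ n"
proof (cases "n = 0")
  case False
  then have "prob (\<Inter>i\<in>{..<n}. X i -` S \<inter> space P) = (\<Prod>i\<in>{..<n}. prob (X i -` S \<inter> space P))"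
    using indep_X by (intro indep_varsD) auto
  moreover have "(\<Inter>i\<in>{..<n}. X i -` S \<inter> space P) = {\<omega> \<in> space P. \<forall>i<n. X i \<omega> \<in> S}"
    using False by auto
  moreover have "X i -` S \<inter> space P = {\<omega> \<in> space P. X i \<omega> \<in> S}" for i
    by auto
  ultimately show ?thesis
    by (simp add: prob_X_in)
qed (simp add: prob_space)

text \<open>Taken on the product measure so that it does not refer to a pair of indices. It turns
  out to be the sum of the squared masses of the atoms in \<open>S\<close>.\<close>

definition coincidence_prob :: "'a set \<Rightarrow> real" where
  "coincidence_prob S
    = measure (M \<Otimes>\<^sub>M M) {p \<in> space (M \<Otimes>\<^sub>M M). fst p = snd p \<and> fst p \<in> S}"

lemma prob_X_eq_X:
  assumes [measurable]: "S \<in> sets M" and "i \<noteq> j"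
  shows "\<P>(\<omega> in P. X i \<omega> = X j \<omega> \<and> X i \<omega> \<in> S) = coincidence_prob S"
proof -
  have "indep_var M ((\<lambda>f. f i) \<circ> (\<lambda>\<omega>. restrict (\<lambda>i. X i \<omega>) {i}))
      M ((\<lambda>f. f j) \<circ> (\<lambda>\<omega>. restrict (\<lambda>i. X i \<omega>) {j}))"
    using assms(2) by (intro indep_var_compose[OF indep_var_restrict[OF indep_X]]) auto
  then have "indep_var M (X i) M (X j)"
    by (simp add: comp_def)
  then have "M \<Otimes>\<^sub>M M = distr P (M \<Otimes>\<^sub>M M) (\<lambda>\<omega>. (X i \<omega>, X j \<omega>))"
    by (simp add: indep_var_distribution_eq distr_X)
  then have "coincidence_prob S = measure (distr P (M \<Otimes>\<^sub>M M) (\<lambda>\<omega>. (X i \<omega>, X j \<omega>)))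
      {p \<in> space (M \<Otimes>\<^sub>M M). fst p = snd p \<and> fst p \<in> S}"
    by (simp add: coincidence_prob_def)
  also have "\<dots> = \<P>(\<omega> in P. X i \<omega> = X j \<omega> \<and> X i \<omega> \<in> S)"
    by (subst measure_distr)
      (auto intro!: arg_cong[where f = prob] simp: space_pair_measure X_in_space)
  finally show ?thesis ..
qed

text \<open>The lower bound is a union bound: if all values lie in \<open>S\<close> but are not
  distinct, some pair of different indices coincides. The number of ordered pairs is estimated
  crudely by the square of \<open>n\<close>, which suffices because \<open>n\<close> is fixed while
  the coincidence probability tends to 0.\<close>

lemma distinct_prob_bounds:
  assumes S [measurable]: "S \<in> sets M"
  shows "distinct_prob {..<n} S \<le> measure M S ^ n"
    and "measure M S ^ n - (real n)\<^sup>2 * coincidence_prob S \<le> distinct_prob {..<n} S"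
proof -
  note [measurable] = pred_distinct[OF _ S measurable_X]
  show "distinct_prob {..<n} S \<le> measure M S ^ n"
    unfolding distinct_prob_def prob_all_X_in[OF S, symmetric]
    by (rule finite_measure_mono) auto
  let ?D = "{\<omega> \<in> space P. (\<forall>i\<in>{..<n}. X i \<omega> \<in> S) \<and> inj_on (\<lambda>i. X i \<omega>) {..<n}}"
  let ?I = "{p \<in> {..<n} \<times> {..<n}. fst p \<noteq> snd p}"
  let ?E = "\<lambda>p. {\<omega> \<in> space P. X (fst p) \<omega> = X (snd p) \<omega> \<and> X (fst p) \<omega> \<in> S}"
  have fin: "finite ?I"
    by simp
  have "measure M S ^ n \<le> prob (?D \<union> (\<Union>p\<in>?I. ?E p))"
    unfolding prob_all_X_in[OF S, symmetric]
  proof (rule finite_measure_mono)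
    show "{\<omega> \<in> space P. \<forall>i<n. X i \<omega> \<in> S} \<subseteq> ?D \<union> (\<Union>p\<in>?I. ?E p)"
      by (auto simp: inj_on_def)
  qed (use fin in auto)
  also have "\<dots> \<le> prob ?D + prob (\<Union>p\<in>?I. ?E p)"
    using fin by (intro measure_Un_le) auto
  also have "prob (\<Union>p\<in>?I. ?E p) \<le> (\<Sum>p\<in>?I. prob (?E p))"
    using fin by (intro finite_measure_subadditive_finite) auto
  also have "\<dots> = real (card ?I) * coincidence_prob S"
    by (simp add: prob_X_eq_X)
  also have "\<dots> \<le> (real n)\<^sup>2 * coincidence_prob S"
  proof (rule mult_right_mono)
    have "card ?I \<le> card ({..<n} \<times> {..<n})"
      by (rule card_mono) auto
    then show "real (card ?I) \<le> (real n)\<^sup>2"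
      by (simp add: power2_eq_square flip: of_nat_mult)
  qed (simp add: coincidence_prob_def)
  finally show "measure M S ^ n - (real n)\<^sup>2 * coincidence_prob S \<le> distinct_prob {..<n} S"
    by (simp add: distinct_prob_def)
qed

text \<open>Distinct values are listed increasingly by exactly one ordering of their indices. The
  \<open>n!\<close> orderings thus split the distinctness event into disjoint events, equally likely
  by exchangeability.\<close>

lemma fact_mult_chain_prob_less:
  "fact n * chain_prob (<) n = distinct_prob {..<n} (space M)"
proof -
  let ?L = "permutations_of_set {..<n}"
  define E where "E xs = {\<omega> \<in> space P. sorted_wrt (<) (map (\<lambda>i. X i \<omega>) xs)}" for xs
  have chain_iff: "sorted_wrt (<) (map x [0..<n]) \<longleftrightarrow> chain (<) x 0 n" for x :: "nat \<Rightarrow> 'a"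
    by (auto simp: sorted_wrt_iff_nth_Suc_transp chain_def less_diff_conv)
  have prob_E: "E xs \<in> events \<and> prob (E xs) = chain_prob (<) n" if "xs \<in> ?L" for xs
  proof -
    have xs: "set xs = {..<n}" "distinct xs" "length xs = n"
      using that length_finite_permutations_of_set[OF that] by (auto dest: permutations_of_setD)
    \<comment> \<open>The ordering is extended by the identity from \<open>n\<close> on, giving an
      injection of \<open>nat\<close>.\<close>
    let ?\<pi> = "\<lambda>i. if i < n then xs ! i else i"
    have "inj ?\<pi>"
      using xs nth_mem[of _ xs] by (auto simp: inj_def nth_eq_iff_index_eq)
    have map_eq: "map (\<lambda>i. X i \<omega>) xs = map (\<lambda>i. X (?\<pi> i) \<omega>) [0..<n]" for \<omega>
      using xs by (intro nth_equalityI) auto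
    have E_eq: "E xs = {\<omega> \<in> space P. chain (<) (\<lambda>i. X (?\<pi> i) \<omega>) 0 n}"
      unfolding E_def map_eq chain_iff ..
    have "Measurable.pred (\<Pi>\<^sub>M i\<in>UNIV. M) (\<lambda>x. chain (<) x 0 n)"
      by (rule pred_chain[OF measurable_rel_less]) simp
    from prob_reindex[OF \<open>inj ?\<pi>\<close> this] have "prob (E xs) = chain_prob (<) n"
      unfolding E_eq chain_prob_def .
    moreover have "E xs \<in> events"
      using pred_chain[OF measurable_rel_less, where f = "\<lambda>i. X (?\<pi> i)" and N = P]
      unfolding E_eq pred_def by simp
    ultimately show ?thesis
      by simp
  qed
  have disj: "disjoint_family_on E ?L"
    unfolding disjoint_family_on_def
  proof (intro ballI impI, rule ccontr)
    fix xs ys assume xy: "xs \<in> ?L" "ys \<in> ?L" "xs \<noteq> ys" and "E xs \<inter> E ys \<noteq> {}"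
    then obtain \<omega> where \<omega>: "\<omega> \<in> E xs" "\<omega> \<in> E ys"
      by blast
    let ?x = "\<lambda>i. X i \<omega>"
    have s: "set xs = {..<n}" "set ys = {..<n}"
      using xy by (auto dest: permutations_of_setD)
    have sorted: "sorted_wrt (<) (map ?x xs)" "sorted_wrt (<) (map ?x ys)"
      using \<omega> by (auto simp: E_def)
    \<comment> \<open>A set has only one strictly increasing listing; injectivity of the values on
      the indices then identifies the two orderings.\<close>
    then have "map ?x xs = map ?x ys"
      using s by (intro strict_sorted_equal) auto
    moreover have "inj_on ?x {..<n}"
      using sorted(1) s(1) by (metis distinct_map strict_sorted_iff)
    ultimately have "xs = ys"
      by (intro map_inj_on[of ?x xs ys]) (simp_all only: s Un_absorb)
    with xy(3) show False ..
  qed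
  have "{\<omega> \<in> space P. (\<forall>i\<in>{..<n}. X i \<omega> \<in> space M) \<and> inj_on (\<lambda>i. X i \<omega>) {..<n}} = (\<Union>xs\<in>?L. E xs)"
    (is "?D = _")
  proof
    show "?D \<subseteq> (\<Union>xs\<in>?L. E xs)"
    proof
      fix \<omega> assume \<omega>: "\<omega> \<in> ?D"
      let ?x = "\<lambda>i. X i \<omega>"
      let ?xs = "sort_key ?x [0..<n]"
      have "?xs \<in> ?L"
        by (auto simp: permutations_of_set_def)
      moreover have "sorted_wrt (<) (map ?x ?xs)"
        using \<omega> by (auto simp: strict_sorted_iff distinct_map atLeast0LessThan)
      ultimately show "\<omega> \<in> (\<Union>xs\<in>?L. E xs)"
        using \<omega> by (auto simp: E_def)
    qed
    show "(\<Union>xs\<in>?L. E xs) \<subseteq> ?D"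
    proof safe
      fix xs \<omega> assume "xs \<in> ?L" "\<omega> \<in> E xs"
      then have "set xs = {..<n}" "sorted_wrt (<) (map (\<lambda>i. X i \<omega>) xs)"
        by (auto simp: E_def dest: permutations_of_setD)
      then show "inj_on (\<lambda>i. X i \<omega>) {..<n}"
        by (metis distinct_map strict_sorted_iff)
    qed (auto simp: E_def X_in_space)
  qed
  then have "distinct_prob {..<n} (space M) = prob (\<Union>xs\<in>?L. E xs)"
    by (simp only: distinct_prob_def)
  also have "\<dots> = (\<Sum>xs\<in>?L. prob (E xs))"
    using prob_E disj by (intro finite_measure_finite_Union) auto
  also have "\<dots> = fact n * chain_prob (<) n"
    using prob_E by simp
  finally show ?thesis ..
qed

subsection \<open>Removing the atoms\<close>

text \<open>An exponential generating function: for the whole space the division by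
  \<open>fact n\<close> recovers the strict chain probabilities, and it absorbs the factor
  \<open>Suc n\<close> that arises when a point is removed.\<close>

definition distinct_gf :: "'a set \<Rightarrow> complex \<Rightarrow> complex" where
  "distinct_gf S z = (\<Sum>n. of_real (distinct_prob {..<n} S) * z ^ n / fact n)"

lemma norm_distinct_gf_term_le:
  "norm (of_real (distinct_prob {..<n} S) * z ^ n / fact n :: complex) \<le> norm z ^ n / fact n"
  using mult_right_mono[OF distinct_prob_le_1[of "{..<n}" S], of "norm z ^ n / fact n"]
  by (simp add: norm_mult norm_divide norm_power distinct_prob_nonneg)

lemma summable_norm_power_over_fact: "summable (\<lambda>n. norm (z :: complex) ^ n / fact n)"
  using summable_exp[of "norm z"] by (simp add: field_simps)

lemma summable_norm_distinct_gf:
  "summable (\<lambda>n. norm (of_real (distinct_prob {..<n} S) * z ^ n / fact n :: complex))"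
  using norm_distinct_gf_term_le
  by (intro summable_comparison_test'[OF summable_norm_power_over_fact]) simp

lemma distinct_gf_sums:
  "(\<lambda>n. of_real (distinct_prob {..<n} S) * z ^ n / fact n) sums distinct_gf S z"
  unfolding distinct_gf_def
  by (rule summable_sums[OF summable_norm_cancel[OF summable_norm_distinct_gf]])

lemma distinct_gf_remove_point:
  assumes "S \<in> sets M" "\<alpha> \<in> S"
  shows "distinct_gf S z = (1 + of_real (measure M {\<alpha>}) * z) * distinct_gf (S - {\<alpha>}) z"
proof -
  let ?f = "\<lambda>S n. complex_of_real (distinct_prob {..<n} S) * z ^ n / fact n"
  let ?m = "complex_of_real (measure M {\<alpha>})"
  have "(\<lambda>n. ?f (S - {\<alpha>}) (Suc n) + ?m * z * ?f (S - {\<alpha>}) n)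
      sums (distinct_gf (S - {\<alpha>}) z - 1 + ?m * z * distinct_gf (S - {\<alpha>}) z)"
    by (intro sums_add sums_mult distinct_gf_sums)
      (use distinct_gf_sums[of "S - {\<alpha>}" z] in \<open>subst sums_Suc_iff, simp\<close>)
  moreover have "?f S (Suc n) = ?f (S - {\<alpha>}) (Suc n) + ?m * z * ?f (S - {\<alpha>}) n" for n
    unfolding distinct_prob_remove_point[OF assms]
    by (simp add: field_simps del: of_nat_Suc)
  ultimately have "(\<lambda>n. ?f S (Suc n)) sums
      (distinct_gf (S - {\<alpha>}) z - 1 + ?m * z * distinct_gf (S - {\<alpha>}) z)"
    by (simp only:)
  then have "?f S sums (distinct_gf (S - {\<alpha>}) z + ?m * z * distinct_gf (S - {\<alpha>}) z)"
    by (subst (asm) sums_Suc_iff) simp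
  with distinct_gf_sums[of S z] show ?thesis
    by (simp add: sums_unique2 distrib_right)
qed

lemma distinct_gf_remove_finite:
  assumes "finite F" "S \<in> sets M" "F \<subseteq> S"
  shows "distinct_gf S z = (\<Prod>\<alpha>\<in>F. 1 + of_real (measure M {\<alpha>}) * z) * distinct_gf (S - F) z"
  using assms(1,3)
proof (induction F)
  case (insert \<alpha> F)
  have "{\<beta>} \<in> sets M" if "\<beta> \<in> F" for \<beta>
    using insert.prems that assms(2) sets.sets_into_space by (intro singleton_sets) blast
  then have "F \<in> sets M"
    using sets.countable[of F M] countable_finite[OF insert.hyps(1)] by blast
  then have "S - F \<in> sets M"
    using assms(2) by blast
  then have "distinct_gf (S - F) z
      = (1 + of_real (measure M {\<alpha>}) * z) * distinct_gf (S - F - {\<alpha>}) z"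
    using insert by (intro distinct_gf_remove_point) auto
  moreover have "S - F - {\<alpha>} = S - insert \<alpha> F"
    by auto
  ultimately show ?case
    using insert by (simp add: ac_simps)
qed simp

lemma chain_prob_less: "chain_prob (<) n = distinct_prob {..<n} (space M) / fact n"
  by (simp add: fact_mult_chain_prob_less[symmetric])

lemma summable_norm_chain_less:
  "summable (\<lambda>n. norm (of_real (chain_prob (<) n) * z ^ n :: complex))"
  using summable_norm_distinct_gf[of "space M" z] by (simp add: chain_prob_less)

lemma chain_gf_less: "chain_gf (<) z = distinct_gf (space M) z"
  by (simp add: chain_gf_def distinct_gf_def chain_prob_less)

section \<open>Masses of atoms and limits along finite sets of removed atoms\<close>

lemma countable_atoms: "countable (atoms M)"
  by (rule countable_subset[OF _ M.countable_support]) (auto simp: atoms_def)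

lemma atoms_subset: "atoms M \<subseteq> space M"
  by (auto simp: atoms_def)

lemma countable_sets: "countable A \<Longrightarrow> A \<subseteq> space M \<Longrightarrow> A \<in> sets M"
  using singleton_sets by (blast intro!: sets.countable[of A M])

lemma has_sum_atoms: "((\<lambda>\<alpha>. measure M {\<alpha>}) has_sum measure M (atoms M)) (atoms M)"
proof -
  have "((\<lambda>\<alpha>. measure M {\<alpha>}) has_sum measure M (\<Union>\<alpha>\<in>atoms M. {\<alpha>})) (atoms M)"
    using atoms_subset singleton_sets
    by (intro M.has_sum_measure_UN countable_atoms) (auto simp: disjoint_family_on_def)
  then show ?thesis
    by simp
qed

lemma diffuse_mass_eq: "diffuse_mass M = 1 - measure M (atoms M)"
  using countable_sets[OF countable_atoms atoms_subset]
  by (simp add: diffuse_mass_def M.prob_compl)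

text \<open>Over \<open>S\<close> the diagonal consists of countably many points above atoms and the
  remainder \<open>N\<close>. Every section of \<open>N\<close> is empty or a single non-atom, so
  \<open>N\<close> is null by Fubini.\<close>

lemma has_sum_coincidence_prob:
  assumes [measurable]: "S \<in> sets M"
  shows "((\<lambda>\<alpha>. (measure M {\<alpha>})\<^sup>2) has_sum coincidence_prob S) (atoms M \<inter> S)"
proof -
  interpret MM: pair_prob_space M M ..
  let ?A = "atoms M \<inter> S"
  have [measurable]: "atoms M \<in> sets M"
    by (rule countable_sets[OF countable_atoms atoms_subset])
  have A: "countable ?A" "?A \<subseteq> space M"
    using countable_atoms atoms_subset by auto
  define N where "N = {p \<in> space (M \<Otimes>\<^sub>M M). fst p = snd p \<and> fst p \<in> S \<and> fst p \<notin> atoms M}"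
  have [measurable]: "N \<in> sets (M \<Otimes>\<^sub>M M)"
    unfolding N_def by measurable
  have "emeasure (M \<Otimes>\<^sub>M M) N = (\<integral>\<^sup>+x. emeasure M (Pair x -` N) \<partial>M)"
    by (rule M.emeasure_pair_measure_alt) measurable
  also have "\<dots> = (\<integral>\<^sup>+x. 0 \<partial>M)"
  proof (rule nn_integral_cong)
    fix x assume x: "x \<in> space M"
    have "Pair x -` N = (if x \<in> S \<and> x \<notin> atoms M then {x} else {})"
      using x by (auto simp: N_def space_pair_measure)
    moreover have "emeasure M {x} = 0" if "x \<notin> atoms M"
      using that x by (auto simp: atoms_def M.emeasure_eq_measure not_less measure_le_0_iff)
    ultimately show "emeasure M (Pair x -` N) = 0"
      by simp
  qed
  finally have N0: "measure (M \<Otimes>\<^sub>M M) N = 0"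
    by (simp add: measure_def)
  have sing: "{(\<alpha>, \<alpha>)} \<in> sets (M \<Otimes>\<^sub>M M)"
    "measure (M \<Otimes>\<^sub>M M) {(\<alpha>, \<alpha>)} = (measure M {\<alpha>})\<^sup>2" if "\<alpha> \<in> ?A" for \<alpha>
  proof -
    have [measurable]: "{\<alpha>} \<in> sets M"
      using that A by (intro singleton_sets) auto
    have eq: "{(\<alpha>, \<alpha>)} = {\<alpha>} \<times> {\<alpha>}"
      by auto
    show "{(\<alpha>, \<alpha>)} \<in> sets (M \<Otimes>\<^sub>M M)"
      unfolding eq by measurable
    show "measure (M \<Otimes>\<^sub>M M) {(\<alpha>, \<alpha>)} = (measure M {\<alpha>})\<^sup>2"
      unfolding eq measure_def
      by (subst M.emeasure_pair_measure_Times) (auto simp: enn2real_mult power2_eq_square)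
  qed
  have "((\<lambda>\<alpha>. measure (M \<Otimes>\<^sub>M M) {(\<alpha>, \<alpha>)}) has_sum measure (M \<Otimes>\<^sub>M M) (\<Union>\<alpha>\<in>?A. {(\<alpha>, \<alpha>)})) ?A"
    using A sing by (intro MM.P.has_sum_measure_UN) (auto simp: disjoint_family_on_def)
  moreover have "coincidence_prob S = measure (M \<Otimes>\<^sub>M M) (\<Union>\<alpha>\<in>?A. {(\<alpha>, \<alpha>)})"
  proof -
    have "{p \<in> space (M \<Otimes>\<^sub>M M). fst p = snd p \<and> fst p \<in> S} = (\<Union>\<alpha>\<in>?A. {(\<alpha>, \<alpha>)}) \<union> N"
      using A by (auto simp: N_def space_pair_measure)
    then have "coincidence_prob S = measure (M \<Otimes>\<^sub>M M) ((\<Union>\<alpha>\<in>?A. {(\<alpha>, \<alpha>)}) \<union> N)"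
      by (simp add: coincidence_prob_def)
    also have "\<dots> = measure (M \<Otimes>\<^sub>M M) (\<Union>\<alpha>\<in>?A. {(\<alpha>, \<alpha>)}) + measure (M \<Otimes>\<^sub>M M) N"
      using A sing by (intro MM.P.finite_measure_Union sets.countable_UN') (auto simp: N_def)
    finally show ?thesis
      by (simp add: N0)
  qed
  ultimately show ?thesis
    by (subst has_sum_cong[OF sing(2), symmetric]) simp_all
qed

lemma finite_atoms_sets: "finite F \<Longrightarrow> F \<subseteq> atoms M \<Longrightarrow> F \<in> sets M"
  using atoms_subset by (intro countable_sets countable_finite) auto

lemma coincidence_prob_diff_finite:
  assumes "finite F" "F \<subseteq> atoms M"
  shows "coincidence_prob (space M - F) = coincidence_prob (space M) - (\<Sum>\<alpha>\<in>F. (measure M {\<alpha>})\<^sup>2)"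
proof -
  have "F \<in> sets M"
    using assms by (rule finite_atoms_sets)
  have "((\<lambda>\<alpha>. (measure M {\<alpha>})\<^sup>2) has_sum coincidence_prob (space M)) (atoms M)"
    using has_sum_coincidence_prob[of "space M"] atoms_subset by (simp add: Int_absorb2)
  then have "((\<lambda>\<alpha>. (measure M {\<alpha>})\<^sup>2) has_sum
      (coincidence_prob (space M) - (\<Sum>\<alpha>\<in>F. (measure M {\<alpha>})\<^sup>2))) (atoms M - F)"
    using assms by (intro has_sum_Diff) auto
  moreover have "((\<lambda>\<alpha>. (measure M {\<alpha>})\<^sup>2) has_sum coincidence_prob (space M - F)) (atoms M - F)"
  proof -
    have "atoms M - F = atoms M \<inter> (space M - F)"
      using atoms_subset by auto
    then show ?thesis
      using has_sum_coincidence_prob[of "space M - F"] \<open>F \<in> sets M\<close> by simp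
  qed
  ultimately show ?thesis
    by (rule has_sum_unique[symmetric])
qed

text \<open>With \<open>n\<close> fixed, the mass left after removing \<open>F\<close> tends to the
  diffuse mass, while the coincidence probability is the part of a convergent sum of squares outside
  \<open>F\<close> and tends to 0. Both bounds of \<open>distinct_prob_bounds\<close> therefore have
  the same limit.\<close>

lemma tendsto_distinct_prob:
  "((\<lambda>F. distinct_prob {..<n} (space M - F)) \<longlongrightarrow> diffuse_mass M ^ n)
     (finite_subsets_at_top (atoms M))"
proof -
  let ?At = "finite_subsets_at_top (atoms M)"
  have ev: "eventually (\<lambda>F. finite F \<and> F \<subseteq> atoms M \<and> F \<in> sets M) ?At"
    using finite_atoms_sets by (intro eventually_finite_subsets_at_top_weakI) simp
  have "((\<lambda>F. 1 - (\<Sum>\<alpha>\<in>F. measure M {\<alpha>})) \<longlongrightarrow> diffuse_mass M) ?At"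
    unfolding diffuse_mass_eq using has_sum_atoms by (intro tendsto_intros) (simp add: has_sum_def)
  then have mass: "((\<lambda>F. measure M (space M - F)) \<longlongrightarrow> diffuse_mass M) ?At"
  proof (rule tendsto_cong[THEN iffD1, rotated])
    show "eventually (\<lambda>F. 1 - (\<Sum>\<alpha>\<in>F. measure M {\<alpha>}) = measure M (space M - F)) ?At"
      using ev
    proof eventually_elim
      case (elim F)
      then have "measure M F = (\<Sum>\<alpha>\<in>F. measure M {\<alpha>})"
        using atoms_subset by (intro M.finite_measure_eq_sum_singleton singleton_sets) auto
      with elim show ?case
        by (simp add: M.prob_compl)
    qed
  qed
  have "((\<lambda>F. coincidence_prob (space M) - (\<Sum>\<alpha>\<in>F. (measure M {\<alpha>})\<^sup>2))
      \<longlongrightarrow> coincidence_prob (space M) - coincidence_prob (space M)) ?At"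
    using has_sum_coincidence_prob[of "space M"] atoms_subset
    by (intro tendsto_intros) (simp add: has_sum_def Int_absorb2)
  then have "((\<lambda>F. coincidence_prob (space M) - (\<Sum>\<alpha>\<in>F. (measure M {\<alpha>})\<^sup>2)) \<longlongrightarrow> 0) ?At"
    by simp
  then have coinc: "((\<lambda>F. coincidence_prob (space M - F)) \<longlongrightarrow> 0) ?At"
  proof (rule tendsto_cong[THEN iffD1, rotated])
    show "eventually (\<lambda>F. coincidence_prob (space M) - (\<Sum>\<alpha>\<in>F. (measure M {\<alpha>})\<^sup>2)
        = coincidence_prob (space M - F)) ?At"
      using ev by eventually_elim (simp add: coincidence_prob_diff_finite)
  qed
  show ?thesis
  proof (rule tendsto_sandwich)
    have "((\<lambda>F. measure M (space M - F) ^ n - (real n)\<^sup>2 * coincidence_prob (space M - F))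
        \<longlongrightarrow> diffuse_mass M ^ n - (real n)\<^sup>2 * 0) ?At"
      by (intro tendsto_intros mass coinc)
    then show "((\<lambda>F. measure M (space M - F) ^ n - (real n)\<^sup>2 * coincidence_prob (space M - F))
        \<longlongrightarrow> diffuse_mass M ^ n) ?At"
      by simp
    show "((\<lambda>F. measure M (space M - F) ^ n) \<longlongrightarrow> diffuse_mass M ^ n) ?At"
      by (intro tendsto_intros mass)
    show "eventually (\<lambda>F. measure M (space M - F) ^ n - (real n)\<^sup>2 * coincidence_prob (space M - F)
        \<le> distinct_prob {..<n} (space M - F)) ?At"
      using ev by eventually_elim (simp add: distinct_prob_bounds(2) sets.compl_sets)
    show "eventually (\<lambda>F. distinct_prob {..<n} (space M - F) \<le> measure M (space M - F) ^ n) ?At"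
      using ev by eventually_elim (simp add: distinct_prob_bounds(1) sets.compl_sets)
  qed
qed

lemma tendsto_distinct_gf:
  "((\<lambda>F. distinct_gf (space M - F) z) \<longlongrightarrow> exp (of_real (diffuse_mass M) * z))
     (finite_subsets_at_top (atoms M))"
proof -
  let ?At = "finite_subsets_at_top (atoms M)"
  have "((\<lambda>F. \<Sum>n. of_real (distinct_prob {..<n} (space M - F)) * z ^ n / fact n)
      \<longlongrightarrow> (\<Sum>n. of_real (diffuse_mass M ^ n) * z ^ n / fact n)) ?At"
  \<comment> \<open>Dominated convergence for series: as probabilities are at most 1, the
    exponential series of \<open>norm z\<close> dominates uniformly in \<open>F\<close>.\<close>
  proof (rule tannerys_theorem[THEN conjunct2, THEN conjunct2])
    show "summable (\<lambda>n. norm z ^ n / fact n)"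
      by (rule summable_norm_power_over_fact)
    show "\<forall>\<^sub>F (n, F) in sequentially \<times>\<^sub>F ?At.
        norm (of_real (distinct_prob {..<n} (space M - F)) * z ^ n / fact n) \<le> norm z ^ n / fact n"
      using norm_distinct_gf_term_le by (intro always_eventually) auto
    show "((\<lambda>F. of_real (distinct_prob {..<n} (space M - F)) * z ^ n / fact n)
        \<longlongrightarrow> of_real (diffuse_mass M ^ n) * z ^ n / fact n) ?At" for n
      by (intro tendsto_divide tendsto_mult tendsto_of_real tendsto_distinct_prob tendsto_const) simp
  qed simp
  moreover have "(\<Sum>n. of_real (diffuse_mass M ^ n) * z ^ n / fact n)
      = exp (of_real (diffuse_mass M) * z)"
    unfolding exp_def
    by (rule suminf_cong) (simp add: scaleR_conv_of_real power_mult_distrib divide_inverse)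
  ultimately show ?thesis
    by (simp add: distinct_gf_def)
qed

text \<open>The finite product is \<open>chain_gf (<) z\<close> divided by the generating function
  left after removing \<open>F\<close>. That remainder tends to an exponential, so it is eventually
  nonzero, and the division is legitimate even if some factor of the product vanishes.\<close>

lemma tendsto_prod_atoms:
  "(prod (\<lambda>\<alpha>. 1 + of_real (measure M {\<alpha>}) * z)
      \<longlongrightarrow> chain_gf (<) z * exp (- (of_real (diffuse_mass M) * z)))
     (finite_subsets_at_top (atoms M))"
proof -
  let ?At = "finite_subsets_at_top (atoms M)"
  let ?e = "exp (of_real (diffuse_mass M) * z)"
  have lim: "((\<lambda>F. chain_gf (<) z / distinct_gf (space M - F) z) \<longlongrightarrow> chain_gf (<) z / ?e) ?At"
    by (intro tendsto_intros tendsto_distinct_gf) simp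
  have "eventually (\<lambda>F. distinct_gf (space M - F) z \<noteq> 0) ?At"
    using tendsto_distinct_gf by (rule tendsto_imp_eventually_ne) simp
  moreover have "eventually (\<lambda>F. finite F \<and> F \<subseteq> space M) ?At"
    using atoms_subset by (intro eventually_finite_subsets_at_top_weakI) auto
  ultimately have "eventually (\<lambda>F. chain_gf (<) z / distinct_gf (space M - F) z
      = (\<Prod>\<alpha>\<in>F. 1 + of_real (measure M {\<alpha>}) * z)) ?At"
  proof eventually_elim
    case (elim F)
    then show ?case
      using distinct_gf_remove_finite[of F "space M" z] by (simp add: chain_gf_less)
  qed
  from tendsto_cong[THEN iffD1, OF this lim] show ?thesis
    by (simp add: exp_minus divide_inverse)
qed

subsection \<open>Reciprocity of strict and non-strict chains\<close>

lemma chain_prob_compl_2: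
  assumes "measurable_rel r"
  shows "chain_prob (\<lambda>x y. \<not> r x y) 2 = 1 - chain_prob r 2"
proof -
  note [measurable] = pred_rel[OF assms]
  have "\<P>(\<omega> in P. True \<and> \<not> r (X 0 \<omega>) (X 1 \<omega>))
      = \<P>(\<omega> in P. True) - \<P>(\<omega> in P. r (X 0 \<omega>) (X 1 \<omega>))"
    by (rule prob_conj_not) auto
  then show ?thesis
    by (simp add: chain_prob_def chain_def prob_space)
qed

lemma chain_prob_flip:
  assumes "measurable_rel r"
  shows "chain_prob (\<lambda>x y. r y x) n = chain_prob r n"
proof -
  \<comment> \<open>Reversal of the first \<open>n\<close> indices, the identity beyond them; link
    \<open>j\<close> is exchanged with link \<open>n - 2 - j\<close>.\<close>
  let ?\<pi> = "\<lambda>i. if i < n then n - 1 - i else i"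
  have "inj ?\<pi>"
    by (auto simp: inj_def split: if_splits)
  have "chain (\<lambda>x y. r y x) x 0 n \<longleftrightarrow> chain r (\<lambda>i. x (?\<pi> i)) 0 n" for x
  proof
    assume *: "chain (\<lambda>x y. r y x) x 0 n"
    show "chain r (\<lambda>i. x (?\<pi> i)) 0 n"
      unfolding chain_def
    proof (intro allI impI)
      fix j assume "j < n - 1"
      then have "?\<pi> j = Suc (n - 2 - j)" "?\<pi> (Suc j) = n - 2 - j" "n - 2 - j < n - 1"
        by auto
      then show "r (x (?\<pi> (0 + j))) (x (?\<pi> (Suc (0 + j))))"
        using *[unfolded chain_def, rule_format, of "n - 2 - j"] by (simp only: add_0)
    qed
  next
    assume *: "chain r (\<lambda>i. x (?\<pi> i)) 0 n"
    show "chain (\<lambda>x y. r y x) x 0 n"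
      unfolding chain_def
    proof (intro allI impI)
      fix j assume "j < n - 1"
      then have "?\<pi> (n - 2 - j) = Suc j" "?\<pi> (Suc (n - 2 - j)) = j" "n - 2 - j < n - 1"
        by auto
      then show "r (x (Suc (0 + j))) (x (0 + j))"
        using *[unfolded chain_def, rule_format, of "n - 2 - j"] by (simp only: add_0)
    qed
  qed
  moreover have "Measurable.pred (\<Pi>\<^sub>M i\<in>UNIV. M) (\<lambda>x. chain r x 0 n)"
    by (rule pred_chain[OF assms]) simp
  ultimately show ?thesis
    using prob_reindex[OF \<open>inj ?\<pi>\<close>, of "\<lambda>x. chain r x 0 n"] by (simp add: chain_prob_def)
qed

text \<open>The two chains use disjoint blocks of indices, hence are independent; the link between
  members \<open>m - 1\<close> and \<open>m\<close> is left free.\<close>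

lemma prob_adjacent_chains:
  assumes "measurable_rel r" "measurable_rel s"
  shows "\<P>(\<omega> in P. chain r (\<lambda>j. X j \<omega>) 0 m \<and> chain s (\<lambda>j. X j \<omega>) m n)
       = chain_prob r m * chain_prob s n"
proof -
  have 1: "Measurable.pred (\<Pi>\<^sub>M i\<in>{..<m}. M) (\<lambda>x. chain r x 0 m)"
    using pred_chain[OF assms(1), of 0 m "\<lambda>i x. x i" "\<Pi>\<^sub>M i\<in>{..<m}. M"] by simp
  have 2: "Measurable.pred (\<Pi>\<^sub>M i\<in>{m..}. M) (\<lambda>x. chain s x m n)"
    using pred_chain[OF assms(2), of m n "\<lambda>i x. x i" "\<Pi>\<^sub>M i\<in>{m..}. M"] by simp
  have 3: "chain r (\<lambda>i\<in>{..<m}. X i \<omega>) 0 m \<longleftrightarrow> chain r (\<lambda>i. X i \<omega>) 0 m"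
    "chain s (\<lambda>i\<in>{m..}. X i \<omega>) m n \<longleftrightarrow> chain s (\<lambda>i. X i \<omega>) m n" for \<omega>
    by (auto simp: chain_def)
  have "{..<m} \<inter> {m..} = {}"
    by auto
  from prob_indep_conj[OF this 1 2] show ?thesis
    unfolding 3 prob_chain[OF assms(1)] prob_chain[OF assms(2)] .
qed

lemma chain_prob_add_le:
  assumes "measurable_rel r"
  shows "chain_prob r (m + n) \<le> chain_prob r m * chain_prob r n"
proof -
  note [measurable] = pred_chain[where f = X and N = P, OF assms measurable_X]
  have "chain r x 0 m \<and> chain r x m n" if "chain r x 0 (m + n)" for x :: "nat \<Rightarrow> 'a"
    using that by (auto simp: chain_def)
  then have "chain_prob r (m + n)
      \<le> \<P>(\<omega> in P. chain r (\<lambda>j. X j \<omega>) 0 m \<and> chain r (\<lambda>j. X j \<omega>) m n)"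
    unfolding chain_prob_def by (intro finite_measure_mono) auto
  then show ?thesis
    by (simp add: prob_adjacent_chains[OF assms assms])
qed

text \<open>Submultiplicativity makes the chain probabilities decay geometrically, by a factor
  \<open>chain_prob r 2 < 1\<close> for every two members. This gives absolute convergence on the
  closed unit disc, boundary included.\<close>

lemma summable_norm_chain:
  assumes "measurable_rel r" "chain_prob r 2 < 1" "norm z \<le> 1"
  shows "summable (\<lambda>n. norm (of_real (chain_prob r n) * z ^ n :: complex))"
proof -
  \<comment> \<open>The constant 1/4 only keeps \<open>q\<close> positive, so that division by
    \<open>sqrt q\<close> is possible; any number strictly between 0 and 1 would serve.\<close>
  define q where "q = max (chain_prob r 2) (1 / 4)"
  have q: "0 < q" "q < 1" "chain_prob r 2 \<le> q" "sqrt q \<le> 1"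
    using assms(2) by (auto simp: q_def)
  \<comment> \<open>The induction advances by two members; the extra \<open>sqrt q\<close> on the
    left accommodates the odd case, with equality at \<open>n = 1\<close>.\<close>
  have bound: "chain_prob r n * sqrt q \<le> sqrt q ^ n" for n
  proof (induction n rule: induct_nat_012)
    case (ge2 n)
    have "chain_prob r (Suc (Suc n)) * sqrt q \<le> (chain_prob r n * chain_prob r 2) * sqrt q"
      using chain_prob_add_le[OF assms(1), of n 2] q by (intro mult_right_mono) auto
    also have "\<dots> = chain_prob r 2 * (chain_prob r n * sqrt q)"
      by simp
    also have "\<dots> \<le> q * sqrt q ^ n"
      using q ge2 chain_prob_nonneg by (intro mult_mono) auto
    also have "\<dots> = sqrt q ^ Suc (Suc n)"
      using q by (simp flip: mult.assoc)
    finally show ?case .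
  qed (use q in simp_all)
  show ?thesis
  proof (rule summable_comparison_test')
    show "summable (\<lambda>n. sqrt q ^ n / sqrt q)"
      using q by (intro summable_divide summable_geometric) auto
    fix n
    have "chain_prob r n * norm z ^ n \<le> chain_prob r n * 1"
      using assms(3) chain_prob_nonneg by (intro mult_left_mono power_le_one) auto
    also have "\<dots> \<le> sqrt q ^ n / sqrt q"
      using bound[of n] q by (simp add: pos_le_divide_eq)
    finally show "norm (norm (of_real (chain_prob r n) * z ^ n :: complex)) \<le> sqrt q ^ n / sqrt q"
      by (simp add: norm_mult norm_power chain_prob_nonneg)
  qed
qed

text \<open>The link joining an initial \<open>r\<close>-chain to the \<open>\<not> r\<close>-chain that follows it is unconstrained.
  Splitting on its type turns the alternating sum into a telescoping one.\<close>

lemma chain_prob_convolution: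
  assumes "measurable_rel r"
  shows "(\<Sum>m\<le>Suc n. chain_prob r m * ((- 1) ^ m * chain_prob (\<lambda>x y. \<not> r x y) (Suc n - m))) = 0"
proof -
  let ?s = "\<lambda>x y. \<not> r x y"
  note s = measurable_rel_compl[OF assms]
  \<comment> \<open>Here the two chains share \<open>X m\<close>, so every link among the
    \<open>n + 1\<close> variables is prescribed: first \<open>m\<close> links of type
    \<open>r\<close>, then \<open>n - m\<close> of the complementary type.\<close>
  define D where "D m = \<P>(\<omega> in P. chain r (\<lambda>j. X j \<omega>) 0 (Suc m)
      \<and> chain ?s (\<lambda>j. X j \<omega>) m (Suc n - m))" for m
  note [measurable] = pred_chain[where f = X and N = P, OF assms measurable_X]
    pred_chain[where f = X and N = P, OF s measurable_X]
  \<comment> \<open>A free link of type \<open>r\<close> leads to \<open>D m\<close>, one of the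
    other type to \<open>D (m - 1)\<close>. For \<open>m = 0\<close> and \<open>m = Suc n\<close>
    one of the chains is empty, there is no free link, and only one term survives.\<close>
  have split: "chain_prob r m * chain_prob ?s (Suc n - m)
      = (if m \<le> n then D m else 0) + (if m = 0 then 0 else D (m - 1))" if "m \<le> Suc n" for m
  proof -
    let ?E = "\<lambda>\<omega>. chain r (\<lambda>j. X j \<omega>) 0 m \<and> chain ?s (\<lambda>j. X j \<omega>) m (Suc n - m)"
    have E: "\<P>(\<omega> in P. ?E \<omega>) = chain_prob r m * chain_prob ?s (Suc n - m)"
      by (rule prob_adjacent_chains[OF assms s])
    consider "m = 0" | "m = Suc n" | "0 < m" "m \<le> n"
      using \<open>m \<le> Suc n\<close> by linarith
    then show ?thesis
    proof cases
      case 1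
      then show ?thesis
        unfolding E[symmetric] by (simp add: D_def)
    next
      case 2
      then show ?thesis
        unfolding E[symmetric] by (simp add: D_def)
    next
      case 3
      then obtain k where k: "m = Suc k"
        by (cases m) auto
      have "\<P>(\<omega> in P. ?E \<omega> \<and> \<not> r (X k \<omega>) (X m \<omega>)) = D k"
        unfolding D_def using 3 k
        by (intro arg_cong[where f = prob]) (auto simp: Suc_diff_le chain_Suc')
      moreover have "\<P>(\<omega> in P. ?E \<omega> \<and> r (X k \<omega>) (X m \<omega>)) = D m"
        unfolding D_def using 3 k
        by (intro arg_cong[where f = prob]) (auto simp: chain_Suc)
      moreover have "\<P>(\<omega> in P. ?E \<omega>) = \<P>(\<omega> in P. ?E \<omega> \<and> r (X k \<omega>) (X m \<omega>))
          + \<P>(\<omega> in P. ?E \<omega> \<and> \<not> r (X k \<omega>) (X m \<omega>))"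
        using pred_rel[OF assms measurable_X measurable_X, of k m]
        by (subst finite_measure_Union[symmetric]) (auto intro!: arg_cong[where f = prob])
      ultimately show ?thesis
        using E 3 k by simp
    qed
  qed
  have "(\<Sum>m\<le>Suc n. chain_prob r m * ((- 1) ^ m * chain_prob ?s (Suc n - m)))
      = (\<Sum>m\<le>Suc n. (- 1) ^ m * (chain_prob r m * chain_prob ?s (Suc n - m)))"
    by (simp only: ac_simps)
  also have "\<dots> = (\<Sum>m\<le>Suc n. (- 1) ^ m * (if m \<le> n then D m else 0)
      + (- 1) ^ m * (if m = 0 then 0 else D (m - 1)))"
    by (intro sum.cong refl) (simp add: split distrib_left)
  also have "\<dots> = (\<Sum>m\<le>Suc n. (- 1) ^ m * (if m \<le> n then D m else 0))
      + (\<Sum>m\<le>Suc n. (- 1) ^ m * (if m = 0 then 0 else D (m - 1)))"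
    by (rule sum.distrib)
  also have "(\<Sum>m\<le>Suc n. (- 1) ^ m * (if m \<le> n then D m else 0)) = (\<Sum>m\<le>n. (- 1) ^ m * D m)"
    by simp
  also have "(\<Sum>m\<le>Suc n. (- 1) ^ m * (if m = 0 then 0 else D (m - 1))) = - (\<Sum>m\<le>n. (- 1) ^ m * D m)"
    by (subst sum.atMost_Suc_shift) (simp add: sum_negf)
  finally show ?thesis
    by simp
qed

text \<open>The coefficients of the Cauchy product are, up to sign, the alternating convolutions
  just shown to vanish; only the constant term 1 remains.\<close>

lemma chain_gf_reciprocal:
  assumes "measurable_rel r"
    and "summable (\<lambda>n. norm (of_real (chain_prob r n) * z ^ n :: complex))"
    and "summable (\<lambda>n. norm (of_real (chain_prob (\<lambda>x y. \<not> r x y) n) * (- z) ^ n :: complex))"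
  shows "chain_gf r z * chain_gf (\<lambda>x y. \<not> r x y) (- z) = 1"
proof -
  let ?s = "\<lambda>x y. \<not> r x y"
  have *: "(\<Sum>i\<le>k. (of_real (chain_prob r i) * z ^ i) * (of_real (chain_prob ?s (k - i)) * (- z) ^ (k - i)))
      = (if k = 0 then 1 else 0 :: complex)" for k
  proof (cases k)
    case (Suc n)
    have summand: "(of_real (chain_prob r i) * z ^ i) * (of_real (chain_prob ?s (k - i)) * (- z) ^ (k - i))
        = (- z) ^ k * of_real (chain_prob r i * ((- 1) ^ i * chain_prob ?s (k - i)))" if "i \<le> k" for i
    proof -
      have "(- z) ^ k = (- z) ^ i * (- z) ^ (k - i)"
        using that by (simp flip: power_add)
      moreover have "z ^ i = (- z) ^ i * (- 1) ^ i"
        by (simp flip: power_mult_distrib)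
      ultimately show ?thesis
        by simp
    qed
    have "(\<Sum>i\<le>k. (of_real (chain_prob r i) * z ^ i) * (of_real (chain_prob ?s (k - i)) * (- z) ^ (k - i)))
        = (- z) ^ k * of_real (\<Sum>i\<le>k. chain_prob r i * ((- 1) ^ i * chain_prob ?s (k - i)))"
      unfolding of_real_sum sum_distrib_left by (intro sum.cong refl summand) simp
    also have "\<dots> = 0"
      unfolding Suc chain_prob_convolution[OF assms(1)] by simp
    finally show ?thesis
      using Suc by simp
  qed simp
  have "chain_gf r z * chain_gf ?s (- z) = (\<Sum>k. if k = 0 then 1 else 0)"
    unfolding chain_gf_def using Cauchy_product[OF assms(2,3)] by (simp only: *)
  also have "\<dots> = 1"
    using sums_single[of 0 "\<lambda>_. 1 :: complex"] by (simp add: sums_iff)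
  finally show ?thesis .
qed

section \<open>Chains of two members and closed forms of the generating functions\<close>

lemma chain_prob_less_2: "chain_prob (<) 2 = (1 - (\<Sum>\<^sub>\<infinity>\<alpha>\<in>atoms M. (measure M {\<alpha>})\<^sup>2)) / 2"
proof -
  have "distinct_prob {..<2} (space M) = \<P>(\<omega> in P. True \<and> \<not> X 0 \<omega> = X 1 \<omega>)"
    unfolding distinct_prob_def
    by (intro arg_cong[where f = prob]) (auto simp: X_in_space numeral_2_eq_2 lessThan_Suc)
  also have "\<dots> = \<P>(\<omega> in P. True) - \<P>(\<omega> in P. X 0 \<omega> = X 1 \<omega>)"
    by (rule prob_conj_not) auto
  also have "\<P>(\<omega> in P. X 0 \<omega> = X 1 \<omega>) = \<P>(\<omega> in P. X 0 \<omega> = X 1 \<omega> \<and> X 0 \<omega> \<in> space M)"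
    by (intro arg_cong[where f = prob]) (auto simp: X_in_space)
  also have "\<dots> = coincidence_prob (space M)"
    by (rule prob_X_eq_X) auto
  also have "coincidence_prob (space M) = (\<Sum>\<^sub>\<infinity>\<alpha>\<in>atoms M. (measure M {\<alpha>})\<^sup>2)"
    using has_sum_coincidence_prob[of "space M"] atoms_subset
    by (simp add: Int_absorb2 infsumI)
  finally show ?thesis
    by (simp add: chain_prob_less prob_space)
qed

lemma chain_prob_le_2: "chain_prob (\<le>) 2 = (1 + (\<Sum>\<^sub>\<infinity>\<alpha>\<in>atoms M. (measure M {\<alpha>})\<^sup>2)) / 2"
proof -
  have "chain_prob (\<le>) 2 = 1 - chain_prob (<) 2"
    using chain_prob_compl_2[OF measurable_rel_greater] chain_prob_flip[OF measurable_rel_less]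
    by (simp add: not_less)
  then show ?thesis
    by (simp add: chain_prob_less_2 field_simps)
qed

text \<open>Here non-degeneracy enters: every atom has mass strictly between 0 and 1, so its square
  is strictly smaller than its mass, and the masses sum to at most 1. The bound makes
  \<open>chain_prob (\<le>) 2\<close> less than 1, hence non-strict runs end with positive
  probability.\<close>

lemma sum_square_atoms_less_1:
  assumes "\<not> degenerate M"
  shows "(\<Sum>\<^sub>\<infinity>\<alpha>\<in>atoms M. (measure M {\<alpha>})\<^sup>2) < 1"
proof (cases "atoms M = {}")
  case False
  then obtain \<alpha> where \<alpha>: "\<alpha> \<in> atoms M"
    by blast
  let ?m = "\<lambda>\<alpha>. measure M {\<alpha>}"
  let ?q = "\<Sum>\<^sub>\<infinity>\<alpha>\<in>atoms M. (?m \<alpha>)\<^sup>2"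
  have "((\<lambda>\<alpha>. (?m \<alpha>)\<^sup>2) has_sum ?q) (atoms M)"
    using has_sum_coincidence_prob[of "space M"] atoms_subset
    by (simp add: Int_absorb2 infsumI)
  then have "((\<lambda>\<alpha>. ?m \<alpha> + - (?m \<alpha>)\<^sup>2) has_sum (measure M (atoms M) + - ?q)) (atoms M)"
    by (intro has_sum_add has_sum_atoms) (simp add: has_sum_uminus)
  moreover have "0 \<le> ?m \<beta> + - (?m \<beta>)\<^sup>2" for \<beta>
    using mult_left_le[of "?m \<beta>" "?m \<beta>"] by (simp add: power2_eq_square)
  ultimately have "(\<Sum>\<alpha>\<in>{\<alpha>}. ?m \<alpha> + - (?m \<alpha>)\<^sup>2) \<le> measure M (atoms M) + - ?q"
    using \<alpha> by (intro finite_sum_le_has_sum) auto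
  moreover have "?m \<alpha> < 1" "0 < ?m \<alpha>"
    using \<alpha> assms M.prob_le_1[of "{\<alpha>}"]
    by (auto simp: degenerate_def atoms_def M.prob_space less_le)
  then have "0 < ?m \<alpha> * (1 - ?m \<alpha>)"
    by simp
  ultimately have "?q < measure M (atoms M)"
    by (simp add: power2_eq_square algebra_simps)
  also have "\<dots> \<le> 1"
    by simp
  finally show ?thesis .
qed simp

lemma chain_gf_less_eq:
  shows "prod_convergent_on (\<lambda>\<alpha>. 1 + of_real (measure M {\<alpha>}) * z) (atoms M)"
    and "chain_gf (<) z = exp (of_real (diffuse_mass M) * z) *
      infprod (\<lambda>\<alpha>. 1 + of_real (measure M {\<alpha>}) * z) (atoms M)"
  using infprod_eqI[OF tendsto_prod_atoms[of z]] by (simp_all add: exp_minus)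

text \<open>The complement of \<open>(\<le>)\<close> is \<open>(>)\<close>, whose chains are
  reversed strict chains. Reciprocity thus expresses the non-strict function at \<open>z\<close>
  through the strict one at \<open>-z\<close>; it also shows the latter to be nonzero, so the limit
  of the strict products at \<open>-z\<close> can be inverted.\<close>

lemma chain_gf_le_eq:
  assumes "\<not> degenerate M" "norm z \<le> 1"
  shows "prod_convergent_on (\<lambda>\<alpha>. 1 / (1 - of_real (measure M {\<alpha>}) * z)) (atoms M)"
    and "chain_gf (\<le>) z = exp (of_real (diffuse_mass M) * z) *
      infprod (\<lambda>\<alpha>. 1 / (1 - of_real (measure M {\<alpha>}) * z)) (atoms M)"
proof -
  let ?e = "exp (of_real (diffuse_mass M) * z)"
  have "chain_prob (\<le>) 2 < 1"
    using sum_square_atoms_less_1[OF assms(1)] by (simp add: chain_prob_le_2)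
  then have le: "summable (\<lambda>n. norm (of_real (chain_prob (\<le>) n) * z ^ n :: complex))"
    by (rule summable_norm_chain[OF measurable_rel_le _ assms(2)])
  have flip: "chain_prob (>) = chain_prob (<)"
    using chain_prob_flip[OF measurable_rel_less] by blast
  have "chain_gf (\<le>) z * chain_gf (>) (- z) = 1"
    using chain_gf_reciprocal[OF measurable_rel_le le] summable_norm_chain_less[of "- z"]
    by (simp add: not_le flip)
  then have recip: "chain_gf (\<le>) z * chain_gf (<) (- z) = 1"
    by (simp add: chain_gf_def flip)
  then have nz: "chain_gf (<) (- z) \<noteq> 0"
    by auto
  have "((\<lambda>F. inverse (\<Prod>\<alpha>\<in>F. 1 + of_real (measure M {\<alpha>}) * - z))
      \<longlongrightarrow> inverse (chain_gf (<) (- z) * ?e)) (finite_subsets_at_top (atoms M))"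
    using tendsto_prod_atoms[of "- z"] nz by (intro tendsto_inverse) auto
  moreover have "(\<lambda>F. inverse (\<Prod>\<alpha>\<in>F. 1 + of_real (measure M {\<alpha>}) * - z))
      = prod (\<lambda>\<alpha>. 1 / (1 - of_real (measure M {\<alpha>}) * z))"
    by (auto simp: prod_inversef[symmetric] comp_def divide_inverse)
  ultimately have "(prod (\<lambda>\<alpha>. 1 / (1 - of_real (measure M {\<alpha>}) * z))
      \<longlongrightarrow> inverse (chain_gf (<) (- z) * ?e)) (finite_subsets_at_top (atoms M))"
    by simp
  note lim = infprod_eqI[OF this]
  show "prod_convergent_on (\<lambda>\<alpha>. 1 / (1 - of_real (measure M {\<alpha>}) * z)) (atoms M)"
    by (rule lim(1))
  show "chain_gf (\<le>) z = ?e * infprod (\<lambda>\<alpha>. 1 / (1 - of_real (measure M {\<alpha>}) * z)) (atoms M)"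
    unfolding lim(2) using recip nz by (simp add: field_simps)
qed

text \<open>The parameter \<open>c\<close> treats both cases at once: it is the sum of squared atom
  masses for strict runs and its negative for non-strict runs.\<close>

lemma run_pgf_Suc:
  assumes "measurable_rel r" "summable (\<lambda>n. of_real (chain_prob r n) * z ^ n)" "z \<noteq> 0"
    and c2: "chain_prob r 2 = (1 - c) / 2" and "1 + c \<noteq> 0"
  shows "run_pgf_converges r P X (Suc i) z"
    and "run_pgf r P X (Suc i) z = 1 + 2 * (z - 1) / (z * (1 + of_real c)) * run_pgf r P X 0 z"
proof -
  have "chain_prob r 2 \<noteq> 1"
    using assms(5) unfolding c2 by (simp add: field_simps)
  note sums = run_pgf_Suc_sums[OF assms(1-3) this, of i]
  then show "run_pgf_converges r P X (Suc i) z"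
    by (simp add: run_pgf_converges_def sums_iff)
  have "1 - complex_of_real (chain_prob r 2) = (1 + of_real c) / 2"
    unfolding c2 by (simp add: field_simps)
  with sums show "run_pgf r P X (Suc i) z
      = 1 + 2 * (z - 1) / (z * (1 + of_real c)) * run_pgf r P X 0 z"
    by (simp add: run_pgf_def sums_iff mult.commute)
qed

end

theorem theorem1:
  fixes M :: "'a::linorder measure"
    and P :: "'w measure"
    and X :: "nat \<Rightarrow> 'w \<Rightarrow> 'a"
  assumes "prob_space M"
    and "{(x, y). x \<in> space M \<and> y \<in> space M \<and> x < y} \<in> sets (M \<Otimes>\<^sub>M M)"
    and "\<not> degenerate M"
    and "prob_space P"
    and "prob_space.indep_vars P (\<lambda>_. M) X UNIV"
    and "\<And>i. distr P M (X i) = M"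
  shows
    "(\<forall>z::complex. z \<noteq> 0 \<longrightarrow>
        run_pgf_converges (<) P X 0 z \<and>
        prod_convergent_on (\<lambda>\<alpha>. 1 + of_real (measure M {\<alpha>}) * z) (atoms M) \<and>
        run_pgf (<) P X 0 z =
          1 / z * (1 + (z - 1) * exp (of_real (diffuse_mass M) * z) *
                     infprod (\<lambda>\<alpha>. 1 + of_real (measure M {\<alpha>}) * z) (atoms M)))
     \<and> (\<forall>z::complex. z \<noteq> 0 \<and> norm z \<le> 1 \<longrightarrow>
        run_pgf_converges (\<le>) P X 0 z \<and>
        prod_convergent_on (\<lambda>\<alpha>. 1 / (1 - of_real (measure M {\<alpha>}) * z)) (atoms M) \<and>
        run_pgf (\<le>) P X 0 z =
          1 / z * (1 + (z - 1) * exp (of_real (diffuse_mass M) * z) *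
                     infprod (\<lambda>\<alpha>. 1 / (1 - of_real (measure M {\<alpha>}) * z)) (atoms M)))
     \<and> (\<forall>i\<ge>1. \<forall>z::complex. z \<noteq> 0 \<longrightarrow>
        run_pgf_converges (<) P X i z \<and>
        run_pgf (<) P X i z =
          1 + 2 * (z - 1) / (z * (1 + of_real (\<Sum>\<^sub>\<infinity>\<alpha>\<in>atoms M. (measure M {\<alpha>})\<^sup>2)))
                * run_pgf (<) P X 0 z)
     \<and> (\<forall>i\<ge>1. \<forall>z::complex. z \<noteq> 0 \<and> norm z \<le> 1 \<longrightarrow>
        run_pgf_converges (\<le>) P X i z \<and>
        run_pgf (\<le>) P X i z =
          1 + 2 * (z - 1) / (z * (1 - of_real (\<Sum>\<^sub>\<infinity>\<alpha>\<in>atoms M. (measure M {\<alpha>})\<^sup>2)))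
                * run_pgf (\<le>) P X 0 z)"
proof -
  interpret iid_sequence P M X
    using assms by (intro iid_sequence.intro iid_sequence_axioms.intro)
  let ?q = "\<Sum>\<^sub>\<infinity>\<alpha>\<in>atoms M. (measure M {\<alpha>})\<^sup>2"
  have q: "0 \<le> ?q" "?q < 1"
    using sum_square_atoms_less_1[OF assms(3)] by (auto intro: infsum_nonneg)
  have less: "summable (\<lambda>n. of_real (chain_prob (<) n) * z ^ n)" for z :: complex
    by (rule summable_norm_cancel[OF summable_norm_chain_less])
  have le: "summable (\<lambda>n. of_real (chain_prob (\<le>) n) * z ^ n)" if "norm z \<le> 1" for z :: complex
    using q that by (intro summable_norm_cancel[OF summable_norm_chain] measurable_rel_le)
      (simp_all add: chain_prob_le_2)
  have pgf_0: "run_pgf_converges r P X 0 z \<and> run_pgf r P X 0 z = 1 / z * (1 + (z - 1) * chain_gf r z)"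
    if "measurable_rel r" "summable (\<lambda>n. of_real (chain_prob r n) * z ^ n)" "z \<noteq> 0" for r z
    using run_pgf_0_sums[OF that] by (simp add: run_pgf_converges_def run_pgf_def sums_iff)
  show ?thesis
  proof (intro conjI allI impI; (elim conjE)?)
    fix z :: complex assume z: "z \<noteq> 0"
    show "run_pgf_converges (<) P X 0 z"
      using pgf_0[OF measurable_rel_less less z] by blast
    show "prod_convergent_on (\<lambda>\<alpha>. 1 + of_real (measure M {\<alpha>}) * z) (atoms M)"
      by (rule chain_gf_less_eq)
    show "run_pgf (<) P X 0 z = 1 / z * (1 + (z - 1) * exp (of_real (diffuse_mass M) * z) *
                     infprod (\<lambda>\<alpha>. 1 + of_real (measure M {\<alpha>}) * z) (atoms M))"
      using pgf_0[OF measurable_rel_less less z] by (simp add: chain_gf_less_eq(2) mult.assoc)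
    fix i :: nat assume "1 \<le> i"
    then obtain k where i: "i = Suc k"
      by (cases i) auto
    have "1 + ?q \<noteq> 0"
      using q by simp
    note suc = run_pgf_Suc[OF measurable_rel_less less z chain_prob_less_2 this, of k]
    show "run_pgf_converges (<) P X i z"
      unfolding i by (rule suc)
    show "run_pgf (<) P X i z = 1 + 2 * (z - 1) / (z * (1 + of_real ?q)) * run_pgf (<) P X 0 z"
      unfolding i by (rule suc)
  next
    fix z :: complex assume z: "z \<noteq> 0" "norm z \<le> 1"
    show "run_pgf_converges (\<le>) P X 0 z"
      using pgf_0[OF measurable_rel_le le[OF z(2)] z(1)] by blast
    show "prod_convergent_on (\<lambda>\<alpha>. 1 / (1 - of_real (measure M {\<alpha>}) * z)) (atoms M)"
      by (rule chain_gf_le_eq[OF assms(3) z(2)])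
    show "run_pgf (\<le>) P X 0 z = 1 / z * (1 + (z - 1) * exp (of_real (diffuse_mass M) * z) *
                     infprod (\<lambda>\<alpha>. 1 / (1 - of_real (measure M {\<alpha>}) * z)) (atoms M))"
      using pgf_0[OF measurable_rel_le le[OF z(2)] z(1)]
      by (simp add: chain_gf_le_eq(2)[OF assms(3) z(2)] mult.assoc)
    fix i :: nat assume "1 \<le> i"
    then obtain k where i: "i = Suc k"
      by (cases i) auto
    have "chain_prob (\<le>) 2 = (1 - - ?q) / 2" "1 + - ?q \<noteq> 0"
      using q by (simp_all add: chain_prob_le_2)
    note suc = run_pgf_Suc[OF measurable_rel_le le[OF z(2)] z(1) this, of k]
    show "run_pgf_converges (\<le>) P X i z"
      unfolding i by (rule suc)
    show "run_pgf (\<le>) P X i z = 1 + 2 * (z - 1) / (z * (1 - of_real ?q)) * run_pgf (\<le>) P X 0 z"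
      using suc(2) unfolding i by simp
  qed
qed

end
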